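(* Assume that $v\in W^{1,p}_0(B_R)$, $0<R<+\infty$, that $\alpha_2\le1$, and that $$\frac{(N-p)\alpha_1}{\alpha_1+1}+(p-1)\Big(\alpha_1-\frac{\alpha_2}{\alpha_2+1}\Big)\ge0.$$ Then for every $q$ with $\frac{Np}{N-p}>q>p$, setting $a=pq/(q-p)$, $$\Big(\int_{B_R}|v|^q\,df\Big)^{\frac1q}\le C\Big(\int_{B_R}|\nabla v|^p\,df\Big)^{\frac1p}\varLambda(R)^{\frac Na-1},$$ where the constant $C$ depends only on $N,p,\alpha_1,\alpha_2$.
   Context: Standing assumptions. $N$ is the space dimension, $B_R$ is the ball of center $0$ and radius $R$ in $\mathbb{R}^N$, $1<p<N$. $f(x)=e^{g(|x|)}$ for $x\in\mathbb{R}^N$ and $df=f(x)\,dx$, where $g\in C([0,+\infty))\cap C^1((0,+\infty))$, $g(0)=0$, $g(s)>0$ for $s>0$, and for given constants $0<\alpha_1\le\alpha_2<\min(N,p/(p-1))$ $$\alpha_1\frac{g(s)}{s}\le g'(s)\le\alpha_2\frac{g(s)}{s},\qquad s>0.$$ Define $G(s)=\frac1s\int_0^s g(z)\,dz$ for $s>0$, and $\varLambda(s)=G'(s)$ for $s>0$, $\varLambda(0)=0$ (so $\varLambda(s)>0$ for $s>0$). *)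

theory Defs
  imports "HOL-Analysis.Analysis"
begin

section \<open>Sobolev spaces on a Euclidean space\<close>

primrec C_k :: "nat \<Rightarrow> ('a::euclidean_space \<Rightarrow> real) \<Rightarrow> bool" where
  "C_k 0 \<phi> \<longleftrightarrow> continuous_on UNIV \<phi>"
| "C_k (Suc k) \<phi> \<longleftrightarrow>
     (\<forall>x. \<phi> differentiable (at x)) \<and>
     (\<forall>i\<in>Basis. C_k k (\<lambda>x. frechet_derivative \<phi> (at x) i))"

definition grad :: "('a::euclidean_space \<Rightarrow> real) \<Rightarrow> 'a \<Rightarrow> 'a" where
  "grad \<phi> x = (\<Sum>i\<in>Basis. frechet_derivative \<phi> (at x) i *\<^sub>R i)"

definition test_function :: "'a::euclidean_space set \<Rightarrow> ('a \<Rightarrow> real) \<Rightarrow> bool" where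
  "test_function \<Omega> \<phi> \<longleftrightarrow>
     (\<forall>k. C_k k \<phi>) \<and> compact (closure {x. \<phi> x \<noteq> 0}) \<and> closure {x. \<phi> x \<noteq> 0} \<subseteq> \<Omega>"

text \<open>Elements of the spaces below are functions, not classes of functions modulo
  equality almost everywhere, and their values outside \<open>\<Omega>\<close> are irrelevant.\<close>

definition Lp :: "real \<Rightarrow> 'a::euclidean_space set \<Rightarrow> ('a \<Rightarrow> 'b::euclidean_space) set" where
  "Lp p \<Omega> = {u. set_borel_measurable lebesgue \<Omega> u \<and>
                 (\<lambda>x. norm (u x) powr p) absolutely_integrable_on \<Omega>}"

definition has_weak_gradient ::
    "'a::euclidean_space set \<Rightarrow> ('a \<Rightarrow> real) \<Rightarrow> ('a \<Rightarrow> 'a) \<Rightarrow> bool" where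
  "has_weak_gradient \<Omega> v w \<longleftrightarrow>
     (\<forall>K. compact K \<and> K \<subseteq> \<Omega> \<longrightarrow> v absolutely_integrable_on K \<and> w absolutely_integrable_on K) \<and>
     (\<forall>\<phi>. test_function \<Omega> \<phi> \<longrightarrow>
        (\<forall>i\<in>Basis. (LINT x:\<Omega>|lebesgue. v x * frechet_derivative \<phi> (at x) i)
                  = - (LINT x:\<Omega>|lebesgue. (w x \<bullet> i) * \<phi> x)))"

text \<open>A weak gradient on an open set \<open>\<Omega>\<close> is unique up to equality almost everywhere in
  \<open>\<Omega>\<close>; \<open>weak_grad\<close> picks one representative.\<close>

definition weak_grad :: "'a::euclidean_space set \<Rightarrow> ('a \<Rightarrow> real) \<Rightarrow> 'a \<Rightarrow> 'a" where
  "weak_grad \<Omega> v = (SOME w. has_weak_gradient \<Omega> v w)"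

definition W1 :: "real \<Rightarrow> 'a::euclidean_space set \<Rightarrow> ('a \<Rightarrow> real) set" where
  "W1 p \<Omega> = {v \<in> Lp p \<Omega>. (\<exists>w. has_weak_gradient \<Omega> v w) \<and> weak_grad \<Omega> v \<in> Lp p \<Omega>}"

text \<open>The closure of the test functions in the norm of \<open>W1 p \<Omega>\<close>; convergence in that norm
  is convergence in \<open>Lp p \<Omega>\<close> of the functions and of their gradients.\<close>

definition W1_0 :: "real \<Rightarrow> 'a::euclidean_space set \<Rightarrow> ('a \<Rightarrow> real) set" where
  "W1_0 p \<Omega> = {v \<in> W1 p \<Omega>. \<exists>\<phi>. (\<forall>k::nat. test_function \<Omega> (\<phi> k)) \<and>
     (\<lambda>k. LINT x:\<Omega>|lebesgue. \<bar>v x - \<phi> k x\<bar> powr p) \<longlonglongrightarrow> 0 \<and>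
     (\<lambda>k. LINT x:\<Omega>|lebesgue. norm (weak_grad \<Omega> v x - grad (\<phi> k) x) powr p) \<longlonglongrightarrow> 0}"


section \<open>The weight\<close>

definition weight_exponent :: "real \<Rightarrow> real \<Rightarrow> (real \<Rightarrow> real) \<Rightarrow> bool" where
  "weight_exponent \<alpha>\<^sub>1 \<alpha>\<^sub>2 g \<longleftrightarrow>
     continuous_on {0..} g \<and> g C1_differentiable_on {0<..} \<and>
     g 0 = 0 \<and> (\<forall>s>0. g s > 0) \<and>
     (\<forall>s>0. \<alpha>\<^sub>1 * (g s / s) \<le> deriv g s \<and> deriv g s \<le> \<alpha>\<^sub>2 * (g s / s))"

definition weighted_measure :: "(real \<Rightarrow> real) \<Rightarrow> 'a::euclidean_space measure" where
  "weighted_measure g = density lebesgue (\<lambda>x. ennreal (exp (g (norm x))))"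

definition avg :: "(real \<Rightarrow> real) \<Rightarrow> real \<Rightarrow> real" where
  "avg g s = 1 / s * integral {0..s} g"

definition Lam :: "(real \<Rightarrow> real) \<Rightarrow> real \<Rightarrow> real" where
  "Lam g s = (if s > 0 then deriv (avg g) s else 0)"

end

theory Submission
  imports Defs
begin

text \<open>
  Write \<open>f\<close> for the weight \<open>exp (g (norm x))\<close>, \<open>\<kappa>\<close> for \<open>g R / R\<close> and \<open>m = N * p / (N - p)\<close> for the critical
  exponent. The inequality interpolates, by Hoelder's inequality, between the two extreme exponents
  \<open>p\<close> and \<open>m\<close>: at \<open>p\<close> it becomes a weighted Poincare inequality with constant of order \<open>1 / \<kappa>\<close>
  (lemma \<open>weighted_poincare\<close>), at \<open>m\<close> a weighted Sobolev inequality with a constant independent of \<open>g\<close>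
  and \<open>R\<close> (lemma \<open>weighted_sobolev\<close>). The power of \<open>\<kappa>\<close> obtained in this way is \<open>N / a - 1\<close>. This exponent
  is negative and \<open>0 < Lam g R \<le> \<kappa>\<close> (lemma \<open>Lam_bounds\<close>), so \<open>\<kappa>\<close> may be replaced by \<open>Lam g R\<close>.

  Both extreme inequalities rest on one observation. For a test function \<open>\<phi>\<close> the value
  \<open>\<bar>\<phi> x\<bar> powr \<gamma>\<close> is at most the integral of \<open>\<gamma> * \<bar>\<phi>\<bar> powr (\<gamma> - 1) * norm (grad \<phi>)\<close> along any half-line issuing
  from \<open>x\<close>. If the half-line points away from the origin, the weight increases along it, hence \<open>f x\<close> can be
  multiplied into the estimate and replaced under the integral by the larger values of \<open>f\<close> along the
  half-line.

  For the Poincare inequality \<open>\<gamma> = p\<close>. Because \<open>\<alpha>\<^sub>2 \<le> 1\<close>, the quotient \<open>g s / s\<close> is nonincreasing, so that \<open>g\<close>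
  has slope at least \<open>\<alpha>\<^sub>1 * \<kappa>\<close> on the ball. In a suitable coordinate direction \<open>f\<close> therefore grows
  exponentially with a rate proportional to \<open>\<kappa>\<close>, and the half-line integral, integrated over \<open>x\<close>, gains the
  factor \<open>1 / \<kappa>\<close>. For the Sobolev inequality \<open>\<gamma> = p * (N - 1) / (N - p)\<close>. The half-line bounds in all coordinate
  directions are multiplied, as in the classical proof of Gagliardo and Nirenberg, and the product of
  line integrals is controlled by Finner's inequality (lemma \<open>finner_inequality\<close>). In both cases Hoelder's inequality
  for the gradient term leaves a power of the left-hand side on the right, which can be cancelled.

  Finally, elements of \<open>W1_0\<close> are limits of test functions, and Fatou's lemma carries the inequality over.
\<close>

section \<open>Finner's inequality for weighted products of functions\<close>

text \<open>Real powers of extended nonnegative reals. They are only meant for positive exponents, which is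
  why \<open>top\<close> is mapped to \<open>top\<close>; with them, the product inequalities below hold without any
  integrability hypothesis.\<close>

definition epow :: "ennreal \<Rightarrow> real \<Rightarrow> ennreal" where
  "epow x a = (if x = top then top else ennreal (enn2real x powr a))"

lemma epow_top [simp]: "epow top a = top"
  by (simp add: epow_def)

lemma epow_ennreal [simp]: "0 \<le> r \<Longrightarrow> epow (ennreal r) a = ennreal (r powr a)"
  by (simp add: epow_def)

lemma epow_0 [simp]: "epow 0 a = 0"
  using epow_ennreal[of 0 a] by (simp del: epow_ennreal)

lemma epow_eq_0_iff [simp]: "epow x a = 0 \<longleftrightarrow> x = 0"
  by (cases x) auto

lemma epow_mono:
  assumes "x \<le> y" "0 \<le> a"
  shows "epow x a \<le> epow y a"
proof (cases y)
  case (real s)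
  then obtain r where r: "x = ennreal r" "0 \<le> r" "r \<le> s"
    using assms(1) by (cases x) (auto simp: top_unique)
  with real assms(2) show ?thesis
    by (auto intro!: ennreal_leI powr_mono2)
qed auto

lemma measurable_epow [measurable (raw)]:
  assumes [measurable]: "f \<in> borel_measurable M"
  shows "(\<lambda>x. epow (f x) a) \<in> borel_measurable M"
proof -
  have "{x \<in> space M. f x = top} = f -` {top} \<inter> space M" by auto
  then have [measurable]: "{x \<in> space M. f x = top} \<in> sets M"
    using measurable_sets[OF assms, of "{top}"] by simp
  have "(\<lambda>x. enn2real (f x) powr a) \<in> borel_measurable M"
    by measurable
  then show ?thesis unfolding epow_def by measurable
qed

text \<open>Where all entries are finite and positive this is Jensen's inequality for the convex function
  \<open>exp\<close> at the points \<open>ln (y j)\<close>.\<close>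

lemma weighted_arith_geom_mean_ennreal:
  fixes y :: "'j \<Rightarrow> ennreal" and w :: "'j \<Rightarrow> real"
  assumes J: "finite J" and w: "\<And>j. j \<in> J \<Longrightarrow> 0 < w j" "sum w J = 1"
  shows "(\<Prod>j\<in>J. epow (y j) (w j)) \<le> (\<Sum>j\<in>J. ennreal (w j) * y j)"
proof -
  have ne: "J \<noteq> {}" using w(2) by auto
  consider (inf) "\<exists>j\<in>J. y j = top" | (zero) "\<exists>j\<in>J. y j = 0"
    | (pos) "\<forall>j\<in>J. y j \<noteq> 0 \<and> y j \<noteq> top" by blast
  then show ?thesis
  proof cases
    case inf
    then obtain j where "j \<in> J" "y j = top" by blast
    moreover from this have "ennreal (w j) * y j = top"
      using w(1)[of j] by (simp add: ennreal_mult_top)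
    ultimately have "(\<Sum>j\<in>J. ennreal (w j) * y j) = top"
      using J by (subst ennreal_sum_eq_top) blast+
    then show ?thesis by simp
  next
    case zero
    then have "(\<Prod>j\<in>J. epow (y j) (w j)) = 0" using J by auto
    then show ?thesis by (simp only: zero_le)
  next
    case pos
    define r where "r j = enn2real (y j)" for j
    have r: "y j = ennreal (r j)" "0 < r j" if "j \<in> J" for j
      using pos that by (auto simp: r_def less_top enn2real_positive_iff zero_less_iff_neq_zero)
    have "exp (\<Sum>j\<in>J. w j *\<^sub>R ln (r j)) \<le> (\<Sum>j\<in>J. w j * exp (ln (r j)))"
      using w by (intro convex_on_sum[OF J ne exp_convex]) (auto intro: less_imp_le)
    moreover have "exp (\<Sum>j\<in>J. w j *\<^sub>R ln (r j)) = (\<Prod>j\<in>J. r j powr w j)"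
      unfolding exp_sum[OF J] by (intro prod.cong refl) (simp add: powr_def r(2)[THEN less_imp_neq, symmetric])
    moreover have "(\<Sum>j\<in>J. w j * exp (ln (r j))) = (\<Sum>j\<in>J. w j * r j)"
      using r(2) by (intro sum.cong refl) simp
    ultimately have *: "(\<Prod>j\<in>J. r j powr w j) \<le> (\<Sum>j\<in>J. w j * r j)"
      by simp
    have "(\<Prod>j\<in>J. epow (y j) (w j)) = ennreal (\<Prod>j\<in>J. r j powr w j)"
      using r by (subst prod_ennreal[symmetric]) (auto simp: less_imp_le intro!: prod.cong)
    also have "\<dots> \<le> ennreal (\<Sum>j\<in>J. w j * r j)" by (rule ennreal_leI[OF *])
    also have "\<dots> = (\<Sum>j\<in>J. ennreal (w j) * y j)"
      using r w by (subst sum_ennreal[symmetric]) (auto simp: less_imp_le ennreal_mult intro!: sum.cong)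
    finally show ?thesis .
  qed
qed

text \<open>After dividing each \<open>f j\<close> by its integral the claim is the arithmetic-geometric mean inequality,
  integrated. The division is possible unless some integral is \<open>0\<close> (then the left-hand side
  vanishes) or, with no integral equal to \<open>0\<close>, some integral is \<open>top\<close> (then so is the right-hand side).\<close>

lemma holder_nn_integral:
  fixes f :: "'j \<Rightarrow> 'b \<Rightarrow> ennreal" and w :: "'j \<Rightarrow> real"
  assumes J: "finite J" and w: "\<And>j. j \<in> J \<Longrightarrow> 0 < w j" "sum w J = 1"
    and [measurable]: "\<And>j. j \<in> J \<Longrightarrow> f j \<in> borel_measurable M"
  shows "(\<integral>\<^sup>+x. (\<Prod>j\<in>J. epow (f j x) (w j)) \<partial>M) \<le> (\<Prod>j\<in>J. epow (\<integral>\<^sup>+x. f j x \<partial>M) (w j))"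
proof -
  define A where "A j = (\<integral>\<^sup>+x. f j x \<partial>M)" for j
  consider (zero) "\<exists>j\<in>J. A j = 0" | (inf) "\<forall>j\<in>J. A j \<noteq> 0" "\<exists>j\<in>J. A j = top"
    | (pos) "\<forall>j\<in>J. A j \<noteq> 0 \<and> A j \<noteq> top" by blast
  then show ?thesis
  proof cases
    case zero
    then obtain j where j: "j \<in> J" "A j = 0" by blast
    then have "AE x in M. f j x = 0"
      unfolding A_def by (subst (asm) nn_integral_0_iff_AE) auto
    then have "AE x in M. (\<Prod>j\<in>J. epow (f j x) (w j)) = 0"
      by eventually_elim (use j J in auto)
    then have "(\<integral>\<^sup>+x. (\<Prod>j\<in>J. epow (f j x) (w j)) \<partial>M) = 0"
      by (subst nn_integral_0_iff_AE) auto
    then show ?thesis by simp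
  next
    case inf
    then have "(\<Prod>j\<in>J. epow (A j) (w j)) = top"
      using J by (subst ennreal_prod_eq_top) force+
    then show ?thesis by (simp add: A_def)
  next
    case pos
    define r where "r j = enn2real (A j)" for j
    have r: "A j = ennreal (r j)" "0 < r j" if "j \<in> J" for j
      using pos that by (auto simp: r_def less_top enn2real_positive_iff zero_less_iff_neq_zero)
    define P where "P = (\<Prod>j\<in>J. epow (A j) (w j))"
    have Pr: "P = ennreal (\<Prod>j\<in>J. r j powr w j)"
      using r unfolding P_def by (subst prod_ennreal[symmetric]) (auto simp: less_imp_le intro!: prod.cong)
    have scale: "epow y (w j) = epow (A j) (w j) * epow (ennreal (1 / r j) * y) (w j)" if "j \<in> J" for j y
    proof (cases y)
      case (real s)
      have "s powr w j = r j powr w j * (s / r j) powr w j"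
        using r[OF that] real by (simp flip: powr_mult)
      then show ?thesis using real r[OF that]
        by (simp add: less_imp_le flip: ennreal_mult)
    next
      case top
      then show ?thesis using r[OF that] by (simp add: ennreal_mult_top ennreal_top_mult ennreal_mult_eq_top_iff)
    qed
    have "(\<Prod>j\<in>J. epow (f j x) (w j)) \<le> P * (\<Sum>j\<in>J. ennreal (w j) * (ennreal (1 / r j) * f j x))" for x
    proof -
      have "(\<Prod>j\<in>J. epow (f j x) (w j)) = P * (\<Prod>j\<in>J. epow (ennreal (1 / r j) * f j x) (w j))"
        unfolding P_def prod.distrib[symmetric] by (intro prod.cong refl scale)
      also have "\<dots> \<le> P * (\<Sum>j\<in>J. ennreal (w j) * (ennreal (1 / r j) * f j x))"
        by (intro mult_left_mono weighted_arith_geom_mean_ennreal J w) auto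
      finally show ?thesis .
    qed
    then have "(\<integral>\<^sup>+x. (\<Prod>j\<in>J. epow (f j x) (w j)) \<partial>M)
        \<le> (\<integral>\<^sup>+x. P * (\<Sum>j\<in>J. ennreal (w j) * (ennreal (1 / r j) * f j x)) \<partial>M)"
      by (intro nn_integral_mono)
    also have "\<dots> = P * (\<Sum>j\<in>J. ennreal (w j) * (ennreal (1 / r j) * A j))"
      unfolding A_def
      by (subst nn_integral_cmult, measurable, subst nn_integral_sum)
         (auto simp: nn_integral_cmult intro!: arg_cong2[where f="(*)"] sum.cong)
    also have "(\<Sum>j\<in>J. ennreal (w j) * (ennreal (1 / r j) * A j)) = (\<Sum>j\<in>J. ennreal (w j))"
    proof (intro sum.cong refl)
      fix j assume "j \<in> J"
      from r[OF this] show "ennreal (w j) * (ennreal (1 / r j) * A j) = ennreal (w j)"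
        by (simp add: less_imp_le flip: ennreal_mult)
    qed
    also have "\<dots> = 1" using w by (simp add: less_imp_le)
    finally show ?thesis by (simp add: P_def A_def)
  qed
qed

text \<open>Each \<open>f j\<close> depends only on the coordinates in \<open>S j\<close>, and every coordinate carries total weight one.
  Integrating out a single coordinate \<open>i\<close>, the factors with \<open>i \<notin> S j\<close> are constants, while the
  weights of the others add up to one, so Hoelder's inequality replaces each of these by its integral
  over \<open>i\<close>. What remains is an instance of the same inequality with one coordinate less.
  For \<open>S j = I - {j}\<close> and equal weights this is the Loomis-Whitney inequality.\<close>

lemma finner_inequality:
  fixes f :: "'j \<Rightarrow> ('i \<Rightarrow> real) \<Rightarrow> ennreal" and w :: "'j \<Rightarrow> real"
  assumes "finite I" and J: "finite J" and w: "\<And>j. j \<in> J \<Longrightarrow> 0 < w j"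
    and "\<And>j. j \<in> J \<Longrightarrow> S j \<subseteq> I"
    and "\<And>i. i \<in> I \<Longrightarrow> (\<Sum>j | j \<in> J \<and> i \<in> S j. w j) = 1"
    and "\<And>j. j \<in> J \<Longrightarrow> f j \<in> borel_measurable (\<Pi>\<^sub>M i\<in>S j. lborel)"
  shows "(\<integral>\<^sup>+x. (\<Prod>j\<in>J. epow (f j (restrict x (S j))) (w j)) \<partial>(\<Pi>\<^sub>M i\<in>I. lborel))
       \<le> (\<Prod>j\<in>J. epow (\<integral>\<^sup>+x. f j x \<partial>(\<Pi>\<^sub>M i\<in>S j. lborel)) (w j))"
  using assms(1,4-)
proof (induction I arbitrary: S f rule: finite_induct)
  case empty
  then have "S j = {}" if "j \<in> J" for j using that by auto
  then show ?case by (simp add: PiM_empty nn_integral_count_space_finite restrict_def)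
next
  case (insert i I)
  interpret product_sigma_finite "\<lambda>_::'i. lborel :: real measure" ..
  note [measurable] = insert.prems(3)
  define S' where "S' j = S j - {i}" for j
  define f' where "f' j = (if i \<in> S j then (\<lambda>y. \<integral>\<^sup>+t. f j (y(i := t)) \<partial>lborel) else f j)" for j
  have finS: "finite (S j)" if "j \<in> J" for j
    using insert.prems(1)[OF that] insert.hyps(1) finite_subset by blast
  have Sj: "insert i (S' j) = S j" if "i \<in> S j" for j using that by (auto simp: S'_def)
  have Sj': "S' j = S j" if "i \<notin> S j" for j using that by (auto simp: S'_def)
  have upd: "(\<lambda>(y, t). y(i := t)) \<in> measurable ((\<Pi>\<^sub>M i\<in>S' j. lborel) \<Otimes>\<^sub>M lborel) (\<Pi>\<^sub>M i\<in>S j. lborel)"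
    if "i \<in> S j" for j
    using measurable_add_dim[of i "S' j" "\<lambda>_. lborel"] Sj[OF that] by simp
  have f'_meas [measurable]: "f' j \<in> borel_measurable (\<Pi>\<^sub>M i\<in>S' j. lborel)" if "j \<in> J" for j
  proof (cases "i \<in> S j")
    case True
    have "(\<lambda>(y, t). f j (y(i := t))) \<in> borel_measurable ((\<Pi>\<^sub>M i\<in>S' j. lborel) \<Otimes>\<^sub>M lborel)"
      using measurable_compose[OF upd[OF True] insert.prems(3)[OF that]]
      unfolding split_beta' .
    then show ?thesis using True
      by (simp add: f'_def lborel.borel_measurable_nn_integral)
  next
    case False
    then show ?thesis using insert.prems(3)[OF that] by (simp add: f'_def Sj')
  qed
  have f'_int: "(\<integral>\<^sup>+x. f' j x \<partial>(\<Pi>\<^sub>M i\<in>S' j. lborel)) = (\<integral>\<^sup>+x. f j x \<partial>(\<Pi>\<^sub>M i\<in>S j. lborel))"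
    if "j \<in> J" for j
  proof (cases "i \<in> S j")
    case True
    then show ?thesis
      using product_nn_integral_insert[of "S' j" i "f j"] finS[OF that] insert.prems(3)[OF that] Sj[OF True]
      by (simp add: f'_def) (simp add: S'_def)
  next
    case False
    then show ?thesis by (simp add: f'_def Sj')
  qed
  have restr_meas: "(\<lambda>x. restrict x (S j)) \<in> measurable (\<Pi>\<^sub>M i\<in>insert i I. lborel) (\<Pi>\<^sub>M i\<in>S j. lborel)"
    if "j \<in> J" for j
    using insert.prems(1)[OF that] by (rule measurable_restrict_subset)
  have slice: "(\<integral>\<^sup>+t. (\<Prod>j\<in>J. epow (f j (restrict (x(i := t)) (S j))) (w j)) \<partial>lborel)
      \<le> (\<Prod>j\<in>J. epow (f' j (restrict x (S' j))) (w j))" if x: "x \<in> space (\<Pi>\<^sub>M i\<in>I. lborel)" for x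
  proof -
    define J1 where "J1 = {j\<in>J. i \<in> S j}"
    define J2 where "J2 = {j\<in>J. i \<notin> S j}"
    have JJ: "J = J1 \<union> J2" "J1 \<inter> J2 = {}" "finite J1" "finite J2"
      using J by (auto simp: J1_def J2_def)
    have r1: "restrict (x(i := t)) (S j) = (restrict x (S' j))(i := t)" if "j \<in> J1" for j t
      using that by (auto simp: J1_def S'_def fun_eq_iff)
    have r2: "restrict (x(i := t)) (S j) = restrict x (S' j)" if "j \<in> J2" for j t
      using that by (auto simp: J2_def S'_def fun_eq_iff)
    have sec: "(\<lambda>t. f j ((restrict x (S' j))(i := t))) \<in> borel_measurable lborel" if "j \<in> J1" for j
    proof -
      have "restrict x (S' j) \<in> space (\<Pi>\<^sub>M i\<in>S' j. lborel)"
        using x by (auto simp: space_PiM PiE_def extensional_def)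
      then have "(\<lambda>t. (restrict x (S' j))(i := t)) \<in> measurable lborel (\<Pi>\<^sub>M i\<in>S j. lborel)"
        using measurable_compose[OF measurable_Pair1' upd[of j]] that by (simp add: J1_def)
      from measurable_compose[OF this insert.prems(3)[of j]] that show ?thesis
        unfolding J1_def by blast
    qed
    have "(\<integral>\<^sup>+t. (\<Prod>j\<in>J. epow (f j (restrict (x(i := t)) (S j))) (w j)) \<partial>lborel)
        = (\<integral>\<^sup>+t. (\<Prod>j\<in>J2. epow (f' j (restrict x (S' j))) (w j)) *
                (\<Prod>j\<in>J1. epow (f j ((restrict x (S' j))(i := t))) (w j)) \<partial>lborel)"
    proof (rule nn_integral_cong)
      fix t :: real
      have "(\<Prod>j\<in>J. epow (f j (restrict (x(i := t)) (S j))) (w j))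
          = (\<Prod>j\<in>J1. epow (f j (restrict (x(i := t)) (S j))) (w j)) *
            (\<Prod>j\<in>J2. epow (f j (restrict (x(i := t)) (S j))) (w j))"
        unfolding JJ(1) by (rule prod.union_disjoint[OF JJ(3,4,2)])
      also have "(\<Prod>j\<in>J1. epow (f j (restrict (x(i := t)) (S j))) (w j))
          = (\<Prod>j\<in>J1. epow (f j ((restrict x (S' j))(i := t))) (w j))"
        by (intro prod.cong refl) (simp only: r1)
      also have "(\<Prod>j\<in>J2. epow (f j (restrict (x(i := t)) (S j))) (w j))
          = (\<Prod>j\<in>J2. epow (f' j (restrict x (S' j))) (w j))"
        by (intro prod.cong refl) (simp add: r2, simp add: f'_def J2_def)
      finally show "(\<Prod>j\<in>J. epow (f j (restrict (x(i := t)) (S j))) (w j))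
          = (\<Prod>j\<in>J2. epow (f' j (restrict x (S' j))) (w j)) *
            (\<Prod>j\<in>J1. epow (f j ((restrict x (S' j))(i := t))) (w j))"
        by (simp only: mult.commute)
    qed
    also have "\<dots> = (\<Prod>j\<in>J2. epow (f' j (restrict x (S' j))) (w j)) *
                (\<integral>\<^sup>+t. (\<Prod>j\<in>J1. epow (f j ((restrict x (S' j))(i := t))) (w j)) \<partial>lborel)"
      using sec by (intro nn_integral_cmult borel_measurable_prod_ennreal measurable_epow)
    also have "\<dots> \<le> (\<Prod>j\<in>J2. epow (f' j (restrict x (S' j))) (w j)) *
                (\<Prod>j\<in>J1. epow (\<integral>\<^sup>+t. f j ((restrict x (S' j))(i := t)) \<partial>lborel) (w j))"
      using sec w insert.prems(2)[of i]
      by (intro mult_left_mono holder_nn_integral JJ) (auto simp: J1_def)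
    also have "\<dots> = (\<Prod>j\<in>J. epow (f' j (restrict x (S' j))) (w j))"
    proof -
      have "(\<Prod>j\<in>J. epow (f' j (restrict x (S' j))) (w j))
          = (\<Prod>j\<in>J1. epow (f' j (restrict x (S' j))) (w j)) *
            (\<Prod>j\<in>J2. epow (f' j (restrict x (S' j))) (w j))"
        unfolding JJ(1) by (rule prod.union_disjoint[OF JJ(3,4,2)])
      also have "(\<Prod>j\<in>J1. epow (f' j (restrict x (S' j))) (w j))
          = (\<Prod>j\<in>J1. epow (\<integral>\<^sup>+t. f j ((restrict x (S' j))(i := t)) \<partial>lborel) (w j))"
        by (intro prod.cong refl) (simp add: f'_def J1_def)
      finally show ?thesis by (simp only: mult.commute)
    qed
    finally show ?thesis .
  qed
  have meas: "(\<lambda>x. \<Prod>j\<in>J. epow (f j (restrict x (S j))) (w j)) \<in> borel_measurable (\<Pi>\<^sub>M i\<in>insert i I. lborel)"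
    by (intro borel_measurable_prod_ennreal measurable_epow measurable_compose[OF restr_meas insert.prems(3)])
  have "(\<integral>\<^sup>+x. (\<Prod>j\<in>J. epow (f j (restrict x (S j))) (w j)) \<partial>(\<Pi>\<^sub>M i\<in>insert i I. lborel))
      = (\<integral>\<^sup>+x. (\<integral>\<^sup>+t. (\<Prod>j\<in>J. epow (f j (restrict (x(i := t)) (S j))) (w j)) \<partial>lborel) \<partial>(\<Pi>\<^sub>M i\<in>I. lborel))"
    by (rule product_nn_integral_insert[OF insert.hyps meas])
  also have "\<dots> \<le> (\<integral>\<^sup>+x. (\<Prod>j\<in>J. epow (f' j (restrict x (S' j))) (w j)) \<partial>(\<Pi>\<^sub>M i\<in>I. lborel))"
    by (intro nn_integral_mono slice)
  also have "\<dots> \<le> (\<Prod>j\<in>J. epow (\<integral>\<^sup>+x. f' j x \<partial>(\<Pi>\<^sub>M i\<in>S' j. lborel)) (w j))"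
  proof (rule insert.IH)
    show "S' j \<subseteq> I" if "j \<in> J" for j using insert.prems(1)[OF that] by (auto simp: S'_def)
    show "(\<Sum>j | j \<in> J \<and> k \<in> S' j. w j) = 1" if "k \<in> I" for k
    proof -
      have "k \<noteq> i" using that insert.hyps by auto
      then have "{j. j \<in> J \<and> k \<in> S' j} = {j. j \<in> J \<and> k \<in> S j}" by (auto simp: S'_def)
      then show ?thesis using insert.prems(2)[of k] that by simp
    qed
  qed (rule f'_meas)
  also have "\<dots> = (\<Prod>j\<in>J. epow (\<integral>\<^sup>+x. f j x \<partial>(\<Pi>\<^sub>M i\<in>S j. lborel)) (w j))"
    by (intro prod.cong refl arg_cong2[where f=epow] f'_int)
  finally show ?case .
qed

text \<open>Gagliardo's step: the integral of \<open>F\<close> over the line through \<open>x\<close> in direction \<open>i\<close> does not depend on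
  the \<open>i\<close>-th coordinate of \<open>x\<close>. Hence the product on the right is of Loomis-Whitney type, and the
  integral of the factor belonging to \<open>i\<close> over the other coordinates is the full integral of \<open>F\<close>.\<close>

lemma nn_integral_le_product_of_line_integrals:
  fixes F H :: "'a::euclidean_space \<Rightarrow> ennreal"
  assumes [measurable]: "F \<in> borel_measurable borel" "H \<in> borel_measurable borel"
    and dim: "2 \<le> DIM('a)"
    and le: "\<And>x. H x \<le> (\<Prod>i\<in>Basis. epow (\<integral>\<^sup>+t. F (x + t *\<^sub>R i) \<partial>lborel) (1 / real (DIM('a) - 1)))"
  shows "(\<integral>\<^sup>+x. H x \<partial>lborel) \<le> epow (\<integral>\<^sup>+x. F x \<partial>lborel) (1 / real (DIM('a) - 1)) ^ DIM('a)"
proof -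
  interpret product_sigma_finite "\<lambda>_::'a. lborel :: real measure" ..
  define E :: "('a \<Rightarrow> real) \<Rightarrow> 'a" where "E x = (\<Sum>b\<in>Basis. x b *\<^sub>R b)" for x
  define h where "h i y = (\<integral>\<^sup>+t. F (E (y(i := t))) \<partial>lborel)" for i y
  have E_meas [measurable]: "E \<in> measurable (\<Pi>\<^sub>M i\<in>Basis. lborel) borel"
    unfolding E_def by measurable
  have to_prod: "(\<integral>\<^sup>+x. G x \<partial>lborel) = (\<integral>\<^sup>+x. G (E x) \<partial>(\<Pi>\<^sub>M i\<in>Basis. lborel))"
    if [measurable]: "G \<in> borel_measurable borel" for G :: "'a \<Rightarrow> ennreal"
    by (subst lborel_eq, subst nn_integral_distr) (simp_all add: E_def[abs_def])
  have E_upd: "E (x(i := t)) = E x + (t - x i) *\<^sub>R i" if "i \<in> Basis" for x i t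
  proof -
    have "E (x(i := t)) = t *\<^sub>R i + (\<Sum>b\<in>Basis - {i}. x b *\<^sub>R b)"
      using that unfolding E_def by (subst sum.remove[of Basis i]) auto
    moreover have "E x = x i *\<^sub>R i + (\<Sum>b\<in>Basis - {i}. x b *\<^sub>R b)"
      using that unfolding E_def by (subst sum.remove[of Basis i]) auto
    ultimately show ?thesis by (simp add: algebra_simps)
  qed
  have line: "(\<integral>\<^sup>+t. F (E x + t *\<^sub>R i) \<partial>lborel) = h i (restrict x (Basis - {i}))" if "i \<in> Basis" for x i
  proof -
    have "h i (restrict x (Basis - {i})) = (\<integral>\<^sup>+t. F (E (x(i := t))) \<partial>lborel)"
      unfolding h_def by (intro nn_integral_cong arg_cong[where f=F]) (auto simp: E_def intro!: sum.cong)
    also have "\<dots> = (\<integral>\<^sup>+t. F (E x + (- x i + 1 * t) *\<^sub>R i) \<partial>lborel)"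
      using that by (simp add: E_upd)
    also have "\<dots> = (\<integral>\<^sup>+t. F (E x + t *\<^sub>R i) \<partial>lborel)"
      by (subst (2) nn_integral_real_affine[where c=1 and t="- x i"]) auto
    finally show ?thesis by simp
  qed
  have upd: "(\<lambda>(y, t). y(i := t)) \<in> measurable ((\<Pi>\<^sub>M i\<in>Basis - {i}. lborel) \<Otimes>\<^sub>M lborel) (\<Pi>\<^sub>M i\<in>Basis. lborel)"
    if "i \<in> Basis" for i :: 'a
    using measurable_add_dim[of i "Basis - {i}" "\<lambda>_. lborel"] that by (simp add: insert_absorb)
  have FE: "(\<lambda>x. F (E x)) \<in> borel_measurable (\<Pi>\<^sub>M i\<in>Basis. lborel)" by measurable
  have h_meas: "h i \<in> borel_measurable (\<Pi>\<^sub>M i\<in>Basis - {i}. lborel)" if "i \<in> Basis" for i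
  proof -
    have "(\<lambda>(y, t). F (E (y(i := t)))) \<in> borel_measurable ((\<Pi>\<^sub>M i\<in>Basis - {i}. lborel) \<Otimes>\<^sub>M lborel)"
      using measurable_compose[OF upd[OF that] FE] unfolding split_beta' .
    then show ?thesis
      unfolding h_def[abs_def] by (rule lborel.borel_measurable_nn_integral)
  qed
  have h_int: "(\<integral>\<^sup>+y. h i y \<partial>(\<Pi>\<^sub>M i\<in>Basis - {i}. lborel)) = (\<integral>\<^sup>+x. F x \<partial>lborel)" if "i \<in> Basis" for i
  proof -
    have ins: "insert i (Basis - {i}) = (Basis :: 'a set)" using that by auto
    have "(\<integral>\<^sup>+x. F x \<partial>lborel) = (\<integral>\<^sup>+x. F (E x) \<partial>(\<Pi>\<^sub>M i\<in>insert i (Basis - {i}). lborel))"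
      unfolding ins by (rule to_prod) measurable
    also have "\<dots> = (\<integral>\<^sup>+y. h i y \<partial>(\<Pi>\<^sub>M i\<in>Basis - {i}. lborel))"
      unfolding h_def by (rule product_nn_integral_insert) (use FE in \<open>auto simp only: ins finite_Basis finite_Diff\<close>)
    finally show ?thesis ..
  qed
  have "(\<integral>\<^sup>+x. H x \<partial>lborel) = (\<integral>\<^sup>+x. H (E x) \<partial>(\<Pi>\<^sub>M i\<in>Basis. lborel))"
    by (rule to_prod) measurable
  also have "\<dots> \<le> (\<integral>\<^sup>+x. (\<Prod>i\<in>Basis. epow (h i (restrict x (Basis - {i}))) (1 / real (DIM('a) - 1)))
                  \<partial>(\<Pi>\<^sub>M i\<in>Basis. lborel))"
    by (intro nn_integral_mono order_trans[OF le]) (simp add: line cong: prod.cong)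
  also have "\<dots> \<le> (\<Prod>i\<in>Basis. epow (\<integral>\<^sup>+y. h i y \<partial>(\<Pi>\<^sub>M i\<in>Basis - {i}. lborel)) (1 / real (DIM('a) - 1)))"
  proof (rule finner_inequality)
    fix i :: 'a assume "i \<in> Basis"
    then have "{j \<in> Basis. i \<in> Basis - {j}} = Basis - {i}" by auto
    then show "(\<Sum>j | j \<in> Basis \<and> i \<in> Basis - {j}. 1 / real (DIM('a) - 1)) = 1"
      using dim \<open>i \<in> Basis\<close> by (simp add: card_Diff_singleton)
  qed (use dim h_meas in auto)
  also have "\<dots> = epow (\<integral>\<^sup>+x. F x \<partial>lborel) (1 / real (DIM('a) - 1)) ^ DIM('a)"
    by (simp add: h_int)
  finally show ?thesis .
qed

section \<open>Bounding a compactly supported function by integrals along half-lines\<close>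

text \<open>For \<open>\<gamma> > 1\<close> the power is differentiable also at the zeros of \<open>u\<close>, which is what allows the
  fundamental theorem of calculus to be applied to \<open>\<bar>u\<bar> powr \<gamma>\<close> without splitting the domain.\<close>

lemma has_real_derivative_abs_powr:
  fixes \<gamma> :: real
  assumes "1 < \<gamma>" and u: "(u has_real_derivative u') (at t)"
  shows "((\<lambda>t. \<bar>u t\<bar> powr \<gamma>) has_real_derivative \<gamma> * \<bar>u t\<bar> powr (\<gamma> - 1) * sgn (u t) * u') (at t)"
proof -
  have "((\<lambda>x. \<bar>x\<bar> powr \<gamma>) has_real_derivative \<gamma> * \<bar>x\<bar> powr (\<gamma> - 1) * sgn x) (at x)" for x :: real
  proof -
    consider "x > 0" | "x < 0" | "x = 0" by linarith
    then show ?thesis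
    proof cases
      case 1
      have "((\<lambda>x. x powr \<gamma>) has_real_derivative \<gamma> * x powr (\<gamma> - 1)) (at x)"
        using 1 by (intro has_real_derivative_powr)
      then have "((\<lambda>x. \<bar>x\<bar> powr \<gamma>) has_real_derivative \<gamma> * x powr (\<gamma> - 1)) (at x)"
        by (rule has_field_derivative_transform_within_open[where S="{0<..}"]) (use 1 in auto)
      then show ?thesis using 1 by simp
    next
      case 2
      have "((\<lambda>x. (- x) powr \<gamma>) has_real_derivative - (\<gamma> * (- x) powr (\<gamma> - 1))) (at x)"
        using 2 by (auto intro!: derivative_eq_intros)
      then have "((\<lambda>x. \<bar>x\<bar> powr \<gamma>) has_real_derivative - (\<gamma> * (- x) powr (\<gamma> - 1))) (at x)"
        by (rule has_field_derivative_transform_within_open[where S="{..<0}"]) (use 2 in auto)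
      then show ?thesis using 2 by simp
    next
      case 3
      have "((\<lambda>h::real. \<bar>h\<bar> powr (\<gamma> - 1)) \<longlongrightarrow> \<bar>0\<bar> powr (\<gamma> - 1)) (at 0)"
        using assms(1) by (intro tendsto_powr2 tendsto_intros) auto
      then have "((\<lambda>h::real. \<bar>h\<bar> powr (\<gamma> - 1)) \<longlongrightarrow> 0) (at 0)" by simp
      then have "((\<lambda>h::real. \<bar>h\<bar> powr \<gamma> / h) \<longlongrightarrow> 0) (at 0)"
        by (rule Lim_null_comparison[rotated])
           (auto simp: eventually_at_filter powr_diff intro!: always_eventually)
      then show ?thesis using 3 by (simp add: DERIV_def)
    qed
  qed
  from DERIV_chain2[OF this u] show ?thesis by simp
qed

lemma continuous_on_abs_powr:
  fixes f :: "'a::topological_space \<Rightarrow> real"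
  assumes "continuous_on S f" "0 < a"
  shows "continuous_on S (\<lambda>x. \<bar>f x\<bar> powr a)"
  using assms by (intro continuous_on_powr' continuous_intros) auto

lemma abs_powr_le_nn_integral_half_line:
  fixes \<psi> \<psi>' :: "real \<Rightarrow> real"
  assumes \<gamma>: "1 < \<gamma>" and deriv: "\<And>t. (\<psi> has_real_derivative \<psi>' t) (at t)"
    and cont: "continuous_on UNIV \<psi>'" and T: "0 \<le> T" "\<psi> T = 0"
  shows "ennreal (\<bar>\<psi> 0\<bar> powr \<gamma>)
      \<le> (\<integral>\<^sup>+t. ennreal (\<gamma> * \<bar>\<psi> t\<bar> powr (\<gamma> - 1) * \<bar>\<psi>' t\<bar>) * indicator {0..} t \<partial>lborel)"
proof -
  define K where "K t = \<gamma> * \<bar>\<psi> t\<bar> powr (\<gamma> - 1) * \<bar>\<psi>' t\<bar>" for t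
  define D where "D t = \<gamma> * \<bar>\<psi> t\<bar> powr (\<gamma> - 1) * sgn (\<psi> t) * \<psi>' t" for t
  have "continuous_on UNIV \<psi>"
    using deriv by (intro DERIV_continuous_on[of _ _ \<psi>']) (auto intro: has_field_derivative_at_within)
  then have K_cont: "continuous_on UNIV K"
    unfolding K_def using \<gamma> cont by (intro continuous_intros continuous_on_abs_powr) auto
  have "(D has_integral (\<bar>\<psi> T\<bar> powr \<gamma> - \<bar>\<psi> 0\<bar> powr \<gamma>)) {0..T}"
  proof (rule fundamental_theorem_of_calculus[OF T(1)])
    fix t :: real
    have "((\<lambda>t. \<bar>\<psi> t\<bar> powr \<gamma>) has_real_derivative D t) (at t)"
      unfolding D_def by (rule has_real_derivative_abs_powr[OF \<gamma> deriv])
    then show "((\<lambda>t. \<bar>\<psi> t\<bar> powr \<gamma>) has_vector_derivative D t) (at t within {0..T})"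
      unfolding has_real_derivative_iff_has_vector_derivative
      by (rule has_vector_derivative_at_within)
  qed
  then have "((\<lambda>t. - D t) has_integral \<bar>\<psi> 0\<bar> powr \<gamma>) {0..T}"
    using \<gamma> T(2) by (auto dest: has_integral_neg)
  moreover have "K integrable_on {0..T}"
    by (intro integrable_continuous_interval continuous_on_subset[OF K_cont]) auto
  \<comment> \<open>Comparing \<open>- D\<close> with \<open>K\<close> puts the absolute value inside the integral, and \<open>K\<close> is integrable by continuity.\<close>
  moreover have "- D t \<le> K t" for t
  proof -
    have "- (sgn (\<psi> t) * \<psi>' t) \<le> \<bar>\<psi>' t\<bar>" by (auto simp: sgn_if)
    then have "\<gamma> * \<bar>\<psi> t\<bar> powr (\<gamma> - 1) * - (sgn (\<psi> t) * \<psi>' t) \<le> \<gamma> * \<bar>\<psi> t\<bar> powr (\<gamma> - 1) * \<bar>\<psi>' t\<bar>"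
      using \<gamma> by (intro mult_left_mono) auto
    then show ?thesis by (simp add: D_def K_def mult.assoc)
  qed
  ultimately have "\<bar>\<psi> 0\<bar> powr \<gamma> \<le> integral {0..T} K"
    by (intro has_integral_le[OF _ integrable_integral])
  also have si: "set_integrable lborel {0..T} K"
    by (rule borel_integrable_atLeastAtMost') (rule continuous_on_subset[OF K_cont], simp)
  then have "integral {0..T} K = (LINT t:{0..T}|lborel. K t)"
    by (rule set_borel_integral_eq_integral(2)[symmetric])
  finally have "ennreal (\<bar>\<psi> 0\<bar> powr \<gamma>) \<le> ennreal (LINT t:{0..T}|lborel. K t)"
    by (rule ennreal_leI)
  also have "\<dots> = (\<integral>\<^sup>+t. ennreal (indicator {0..T} t *\<^sub>R K t) \<partial>lborel)"
    unfolding set_lebesgue_integral_def using si \<gamma>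
    by (intro nn_integral_eq_integral[symmetric]) (auto simp: set_integrable_def K_def)
  also have "\<dots> \<le> (\<integral>\<^sup>+t. ennreal (K t) * indicator {0..} t \<partial>lborel)"
    by (intro nn_integral_mono) (auto split: split_indicator)
  finally show ?thesis by (simp only: K_def)
qed

text \<open>The only properties of test functions that the inequalities use. Stating the derivative through
  \<open>grad\<close> avoids partial derivatives from here on.\<close>

definition C1_supported :: "real \<Rightarrow> ('a::euclidean_space \<Rightarrow> real) \<Rightarrow> bool" where
  "C1_supported R \<phi> \<longleftrightarrow> (\<forall>x. (\<phi> has_derivative (\<lambda>h. grad \<phi> x \<bullet> h)) (at x)) \<and>
     continuous_on UNIV (grad \<phi>) \<and> (\<forall>x. R \<le> norm x \<longrightarrow> \<phi> x = 0)"

lemma C1_supportedD: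
  assumes "C1_supported R \<phi>"
  shows "(\<phi> has_derivative (\<lambda>h. grad \<phi> x \<bullet> h)) (at x)" "continuous_on UNIV (grad \<phi>)"
    "R \<le> norm x \<Longrightarrow> \<phi> x = 0" "continuous_on UNIV \<phi>"
proof -
  show d: "(\<phi> has_derivative (\<lambda>h. grad \<phi> x \<bullet> h)) (at x)" for x
    using assms by (simp add: C1_supported_def)
  show "continuous_on UNIV \<phi>"
    using d by (auto intro!: continuous_at_imp_continuous_on has_derivative_continuous)
qed (use assms in \<open>auto simp: C1_supported_def\<close>)

lemma test_function_imp_C1_supported:
  assumes "test_function (ball 0 R) \<phi>"
  shows "C1_supported R \<phi>"
proof -
  have "C_k (Suc 0) \<phi>" using assms unfolding test_function_def by blast
  then have diff: "\<phi> differentiable (at x)"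
    and cont: "i \<in> Basis \<Longrightarrow> continuous_on UNIV (\<lambda>x. frechet_derivative \<phi> (at x) i)" for x i
    by auto
  have "(\<phi> has_derivative (\<lambda>h. grad \<phi> x \<bullet> h)) (at x)" for x
  proof -
    have D: "(\<phi> has_derivative frechet_derivative \<phi> (at x)) (at x)"
      using diff by (simp add: frechet_derivative_works)
    then interpret linear "frechet_derivative \<phi> (at x)"
      by (rule has_derivative_linear)
    have "frechet_derivative \<phi> (at x) h = grad \<phi> x \<bullet> h" for h
    proof -
      have "frechet_derivative \<phi> (at x) h = frechet_derivative \<phi> (at x) (\<Sum>i\<in>Basis. (h \<bullet> i) *\<^sub>R i)"
        by (simp add: euclidean_representation)
      also have "\<dots> = (\<Sum>i\<in>Basis. (h \<bullet> i) * frechet_derivative \<phi> (at x) i)"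
        by (simp add: sum scale)
      also have "\<dots> = grad \<phi> x \<bullet> h"
        by (simp add: grad_def inner_sum_left inner_commute[of h] mult.commute)
      finally show ?thesis .
    qed
    then have "frechet_derivative \<phi> (at x) = (\<lambda>h. grad \<phi> x \<bullet> h)" by (rule ext)
    with D show ?thesis by simp
  qed
  moreover have "continuous_on UNIV (grad \<phi>)"
    unfolding grad_def[abs_def]
    by (intro continuous_on_sum continuous_on_scaleR cont continuous_on_const)
  moreover have "\<phi> x = 0" if "R \<le> norm x" for x
  proof (rule ccontr)
    assume "\<phi> x \<noteq> 0"
    then have "x \<in> closure {x. \<phi> x \<noteq> 0}" by (intro subsetD[OF closure_subset]) simp
    moreover have "closure {x. \<phi> x \<noteq> 0} \<subseteq> ball 0 R"
      using assms unfolding test_function_def by blast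
    ultimately show False using that by auto
  qed
  ultimately show ?thesis by (simp add: C1_supported_def)
qed

text \<open>The basic estimate, with a free choice of the unit direction \<open>e\<close>. Choosing \<open>e\<close> so that the half-line
  leaves the origin makes a radially increasing weight increase along it, and the value of the weight at
  \<open>x\<close> can then be moved under the integral without differentiating the weight.\<close>

lemma C1_supported_le_half_line:
  fixes \<phi> :: "'a::euclidean_space \<Rightarrow> real"
  assumes \<phi>: "C1_supported R \<phi>" and \<gamma>: "1 < \<gamma>" and e: "norm e = 1"
  shows "ennreal (\<bar>\<phi> x\<bar> powr \<gamma>)
      \<le> (\<integral>\<^sup>+t. ennreal (\<gamma> * \<bar>\<phi> (x + t *\<^sub>R e)\<bar> powr (\<gamma> - 1) * norm (grad \<phi> (x + t *\<^sub>R e)))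
             * indicator {0..} t \<partial>lborel)"
proof -
  define \<psi> where "\<psi> t = \<phi> (x + t *\<^sub>R e)" for t
  define \<psi>' where "\<psi>' t = grad \<phi> (x + t *\<^sub>R e) \<bullet> e" for t
  have "(\<psi> has_real_derivative \<psi>' t) (at t)" for t
  proof -
    have "((\<lambda>t. x + t *\<^sub>R e) has_derivative (\<lambda>h. h *\<^sub>R e)) (at t)"
      by (auto intro!: derivative_eq_intros)
    from has_derivative_compose[OF this C1_supportedD(1)[OF \<phi>]]
    show ?thesis by (simp add: \<psi>_def[abs_def] \<psi>'_def has_field_derivative_def mult_commute_abs)
  qed
  moreover have "continuous_on UNIV \<psi>'"
    unfolding \<psi>'_def
    by (intro continuous_intros continuous_on_compose2[OF C1_supportedD(2)[OF \<phi>]]) auto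
  \<comment> \<open>At distance \<open>norm x + \<bar>R\<bar>\<close> from \<open>x\<close> the half-line has left the support.\<close>
  moreover have "\<psi> (norm x + \<bar>R\<bar>) = 0"
  proof -
    have "norm ((norm x + \<bar>R\<bar>) *\<^sub>R e) \<le> norm (x + (norm x + \<bar>R\<bar>) *\<^sub>R e) + norm x"
      using norm_triangle_ineq4[of "x + (norm x + \<bar>R\<bar>) *\<^sub>R e" x] by simp
    then have "R \<le> norm (x + (norm x + \<bar>R\<bar>) *\<^sub>R e)" using e by simp
    then show ?thesis unfolding \<psi>_def by (rule C1_supportedD(3)[OF \<phi>])
  qed
  ultimately have "ennreal (\<bar>\<psi> 0\<bar> powr \<gamma>)
      \<le> (\<integral>\<^sup>+t. ennreal (\<gamma> * \<bar>\<psi> t\<bar> powr (\<gamma> - 1) * \<bar>\<psi>' t\<bar>) * indicator {0..} t \<partial>lborel)"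
    by (intro abs_powr_le_nn_integral_half_line[where T="norm x + \<bar>R\<bar>"] \<gamma>) auto
  also have "\<dots> \<le> (\<integral>\<^sup>+t. ennreal (\<gamma> * \<bar>\<phi> (x + t *\<^sub>R e)\<bar> powr (\<gamma> - 1) * norm (grad \<phi> (x + t *\<^sub>R e)))
             * indicator {0..} t \<partial>lborel)"
  proof (intro nn_integral_mono mult_right_mono ennreal_leI)
    fix t
    have "\<bar>\<psi>' t\<bar> \<le> norm (grad \<phi> (x + t *\<^sub>R e))"
      unfolding \<psi>'_def using Cauchy_Schwarz_ineq2[of "grad \<phi> (x + t *\<^sub>R e)" e] e by simp
    then show "\<gamma> * \<bar>\<psi> t\<bar> powr (\<gamma> - 1) * \<bar>\<psi>' t\<bar>
        \<le> \<gamma> * \<bar>\<phi> (x + t *\<^sub>R e)\<bar> powr (\<gamma> - 1) * norm (grad \<phi> (x + t *\<^sub>R e))"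
      using \<gamma> by (auto simp: \<psi>_def intro!: mult_left_mono)
  qed simp
  finally show ?thesis by (simp add: \<psi>_def)
qed

section \<open>Weighted energies of compactly supported functions\<close>

lemma holder_nn_integral_two:
  assumes \<theta>: "0 < \<theta>" "\<theta> < 1" and [measurable]: "f \<in> borel_measurable M" "h \<in> borel_measurable M"
  shows "(\<integral>\<^sup>+x. epow (f x) (1 - \<theta>) * epow (h x) \<theta> \<partial>M)
      \<le> epow (\<integral>\<^sup>+x. f x \<partial>M) (1 - \<theta>) * epow (\<integral>\<^sup>+x. h x \<partial>M) \<theta>"
  using holder_nn_integral[of "UNIV :: bool set" "\<lambda>b. if b then \<theta> else 1 - \<theta>" "\<lambda>b. if b then h else f" M] \<theta>
  by (simp add: UNIV_bool)

lemma holder_nn_integral_powr: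
  fixes u h :: "'b \<Rightarrow> real"
  assumes p: "1 < p" and u: "\<And>x. 0 \<le> u x" and h: "\<And>x. 0 \<le> h x"
    and [measurable]: "u \<in> borel_measurable M" "h \<in> borel_measurable M"
  shows "(\<integral>\<^sup>+x. ennreal (u x powr (m * (1 - 1 / p)) * h x) \<partial>M)
      \<le> epow (\<integral>\<^sup>+x. ennreal (u x powr m) \<partial>M) (1 - 1 / p) * epow (\<integral>\<^sup>+x. ennreal (h x powr p) \<partial>M) (1 / p)"
proof -
  have "ennreal (u x powr (m * (1 - 1 / p)) * h x)
      = epow (ennreal (u x powr m)) (1 - 1 / p) * epow (ennreal (h x powr p)) (1 / p)" for x
    using p u[of x] h[of x] by (simp add: powr_powr ennreal_mult)
  then show ?thesis
    using p holder_nn_integral_two[of "1 / p" "\<lambda>x. ennreal (u x powr m)" M "\<lambda>x. ennreal (h x powr p)"]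
    by simp
qed

text \<open>Cancels the power of the unknown energy \<open>a\<close> on the right. Finiteness of the energy is essential and
  is the reason for working with compactly supported functions first.\<close>

lemma powr_absorb:
  fixes a K c s :: real
  assumes "0 \<le> a" "0 \<le> c" "s < r" "a powr r \<le> a powr s * c"
  shows "a powr (r - s) \<le> c"
proof (cases "a = 0")
  case False
  then show ?thesis using assms by (simp add: powr_diff field_simps)
qed (use assms in auto)

lemma nn_integral_lborel_exp_half_line:
  assumes c: "0 < c"
  shows "(\<integral>\<^sup>+t. ennreal (exp (- (c * t))) * indicator {0..} t \<partial>lborel) = ennreal (1 / c)"
proof -
  have "((\<lambda>t. exp (- (c * t))) \<longlongrightarrow> 0) at_top"
    using c by (auto intro!: filterlim_compose[OF exp_at_bot] filterlim_uminus_at_bot_at_top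
       filterlim_tendsto_pos_mult_at_top tendsto_const filterlim_ident simp: filterlim_uminus_at_bot)
  then have "((\<lambda>t. - exp (- (c * t)) / c) \<longlongrightarrow> - 0 / c) at_top"
    by (intro tendsto_intros) (use c in auto)
  then have "(\<integral>\<^sup>+t. ennreal (exp (- (c * t))) * indicator {0..} t \<partial>lborel) = ennreal (- 0 / c - (- exp (- (c * 0)) / c))"
    using c by (intro nn_integral_FTC_atLeast) (auto intro!: derivative_eq_intros)
  then show ?thesis by simp
qed

lemma nn_integral_continuous_ball_finite:
  fixes h :: "'a::euclidean_space \<Rightarrow> real"
  assumes h: "continuous_on UNIV h" "\<And>x. 0 \<le> h x"
  shows "(\<integral>\<^sup>+x. ennreal (h x) * indicator (ball 0 R) x \<partial>lborel) < \<infinity>"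
proof -
  have "integrable lborel (\<lambda>x. indicator (cball 0 R) x *\<^sub>R h x)"
    by (rule borel_integrable_compact) (auto intro: continuous_on_subset[OF h(1)])
  then have "(\<integral>\<^sup>+x. ennreal (indicator (cball 0 R) x *\<^sub>R h x) \<partial>lborel) < \<infinity>"
    using h(2) by (subst (asm) integrable_iff_bounded) (simp add: abs_mult)
  moreover have "(\<integral>\<^sup>+x. ennreal (h x) * indicator (ball 0 R) x \<partial>lborel)
      \<le> (\<integral>\<^sup>+x. ennreal (indicator (cball 0 R) x *\<^sub>R h x) \<partial>lborel)"
    by (intro nn_integral_mono) (auto split: split_indicator)
  ultimately show ?thesis by simp
qed

lemma nn_integral_lborel_translate:
  fixes F :: "'a::euclidean_space \<Rightarrow> ennreal"
  assumes [measurable]: "F \<in> borel_measurable borel"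
  shows "(\<integral>\<^sup>+x. F (x + c) \<partial>lborel) = (\<integral>\<^sup>+x. F x \<partial>lborel)"
proof -
  have "(\<integral>\<^sup>+x. F x \<partial>lborel) = (\<integral>\<^sup>+x. F x \<partial>distr lborel borel ((+) c))"
    by (simp add: lborel_distr_plus)
  also have "\<dots> = (\<integral>\<^sup>+x. F (x + c) \<partial>lborel)"
    by (subst nn_integral_distr) (auto simp: add.commute)
  finally show ?thesis ..
qed

definition power_energy :: "('a::euclidean_space \<Rightarrow> real) \<Rightarrow> real \<Rightarrow> ('a \<Rightarrow> real) \<Rightarrow> ennreal" where
  "power_energy w m \<phi> = (\<integral>\<^sup>+x. ennreal (w x * \<bar>\<phi> x\<bar> powr m) \<partial>lborel)"

text \<open>Restricted to the ball because only the gradient inside it is controlled; where \<open>\<phi>\<close> vanishes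
  the gradient never enters the estimates.\<close>

definition grad_energy :: "('a::euclidean_space \<Rightarrow> real) \<Rightarrow> real \<Rightarrow> real \<Rightarrow> ('a \<Rightarrow> real) \<Rightarrow> ennreal" where
  "grad_energy w p R \<phi> = (\<integral>\<^sup>+x. ennreal (w x * norm (grad \<phi> x) powr p) * indicator (ball 0 R) x \<partial>lborel)"

lemma power_energy_finite:
  assumes \<phi>: "C1_supported R \<phi>" and w: "continuous_on UNIV w" "\<And>x. 0 \<le> w x" and m: "0 < m"
  shows "power_energy w m \<phi> < \<infinity>"
proof -
  have "power_energy w m \<phi> = (\<integral>\<^sup>+x. ennreal (w x * \<bar>\<phi> x\<bar> powr m) * indicator (ball 0 R) x \<partial>lborel)"
    unfolding power_energy_def
    by (intro nn_integral_cong) (auto split: split_indicator simp: C1_supportedD(3)[OF \<phi>])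
  also have "\<dots> < \<infinity>"
    using m w by (intro nn_integral_continuous_ball_finite continuous_intros
        continuous_on_abs_powr C1_supportedD(4)[OF \<phi>]) auto
  finally show ?thesis .
qed

lemma grad_energy_finite:
  assumes \<phi>: "C1_supported R \<phi>" and w: "continuous_on UNIV w" "\<And>x. 0 \<le> w x" and p: "0 < p"
  shows "grad_energy w p R \<phi> < \<infinity>"
  unfolding grad_energy_def
  using p w by (intro nn_integral_continuous_ball_finite continuous_intros
      continuous_on_powr' C1_supportedD(2)[OF \<phi>]) auto

text \<open>The right-hand sides of both the Poincare and the Sobolev argument are of this mixed form: Hoelder
  splits off the gradient and leaves a power of the very energy that is to be estimated.\<close>

lemma mixed_energy_le:
  fixes w :: "'a::euclidean_space \<Rightarrow> real"
  assumes \<phi>: "C1_supported R \<phi>" and w: "continuous_on UNIV w" "\<And>x. 0 < w x" and p: "1 < p"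
    and \<gamma>: "1 < \<gamma>" "\<gamma> - 1 = m * (1 - 1 / p)"
  shows "(\<integral>\<^sup>+x. ennreal (w x * (\<gamma> * \<bar>\<phi> x\<bar> powr (\<gamma> - 1) * norm (grad \<phi> x))) \<partial>lborel)
      \<le> ennreal \<gamma> * (epow (power_energy w m \<phi>) (1 - 1 / p) * epow (grad_energy w p R \<phi>) (1 / p))"
proof -
  note cont = w(1) C1_supportedD(2,4)[OF \<phi>]
  have [measurable]: "w \<in> borel_measurable borel" "\<phi> \<in> borel_measurable borel"
      "grad \<phi> \<in> borel_measurable borel"
    using cont by (auto intro: borel_measurable_continuous_onI)
  define M where "M = density lborel (\<lambda>x. ennreal (w x))"
  have M_int: "(\<integral>\<^sup>+x. ennreal (f x) \<partial>M) = (\<integral>\<^sup>+x. ennreal (w x * f x) \<partial>lborel)"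
    if "f \<in> borel_measurable borel" for f :: "'a \<Rightarrow> real"
    unfolding M_def using that
    by (subst nn_integral_density)
       (auto simp: less_imp_le[OF w(2)] ennreal_mult'[symmetric] intro!: nn_integral_cong)
  have [measurable_cong]: "sets M = sets borel" by (simp add: M_def)
  let ?h = "\<lambda>x. norm (grad \<phi> x) * indicator (ball 0 R) x"
  have [measurable]: "?h \<in> borel_measurable borel"
    by (intro borel_measurable_times borel_measurable_indicator) auto
  have "(\<integral>\<^sup>+x. ennreal (w x * (\<gamma> * \<bar>\<phi> x\<bar> powr (\<gamma> - 1) * norm (grad \<phi> x))) \<partial>lborel)
      = (\<integral>\<^sup>+x. ennreal \<gamma> * ennreal (w x * (\<bar>\<phi> x\<bar> powr (m * (1 - 1 / p)) * ?h x)) \<partial>lborel)"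
  proof (intro nn_integral_cong)
    fix x
    have "w x * (\<gamma> * \<bar>\<phi> x\<bar> powr (\<gamma> - 1) * norm (grad \<phi> x))
        = \<gamma> * (w x * (\<bar>\<phi> x\<bar> powr (\<gamma> - 1) * ?h x))"
      by (auto simp: C1_supportedD(3)[OF \<phi>] split: split_indicator)
    then show "ennreal (w x * (\<gamma> * \<bar>\<phi> x\<bar> powr (\<gamma> - 1) * norm (grad \<phi> x)))
        = ennreal \<gamma> * ennreal (w x * (\<bar>\<phi> x\<bar> powr (m * (1 - 1 / p)) * ?h x))"
      using \<gamma>(1) by (simp only: \<gamma>(2)[symmetric]) (simp add: ennreal_mult'[symmetric] del: mult_eq_0_iff)
  qed
  also have "\<dots> = ennreal \<gamma> * (\<integral>\<^sup>+x. ennreal (\<bar>\<phi> x\<bar> powr (m * (1 - 1 / p)) * ?h x) \<partial>M)"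
    by (subst nn_integral_cmult) (measurable, simp add: M_int)
  also have "\<dots> \<le> ennreal \<gamma> * (epow (\<integral>\<^sup>+x. ennreal (\<bar>\<phi> x\<bar> powr m) \<partial>M) (1 - 1 / p)
      * epow (\<integral>\<^sup>+x. ennreal (?h x powr p) \<partial>M) (1 / p))"
    by (intro mult_left_mono holder_nn_integral_powr p) auto
  also have "(\<integral>\<^sup>+x. ennreal (\<bar>\<phi> x\<bar> powr m) \<partial>M) = power_energy w m \<phi>"
    by (simp add: M_int power_energy_def)
  also have "(\<integral>\<^sup>+x. ennreal (?h x powr p) \<partial>M) = grad_energy w p R \<phi>"
    unfolding grad_energy_def
    by (subst M_int) (auto intro!: nn_integral_cong split: split_indicator)
  finally show ?thesis .
qed

section \<open>Poincare and Sobolev inequalities for radially increasing weights\<close>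

text \<open>Along the direction of a large coordinate the norm grows at a definite linear rate.\<close>

lemma ex_Basis_coordinate_ge:
  fixes x :: "'a::euclidean_space"
  shows "\<exists>i\<in>Basis. norm x / DIM('a) \<le> \<bar>x \<bullet> i\<bar>"
proof (rule ccontr)
  assume "\<not> ?thesis"
  then have "(\<Sum>i\<in>Basis. \<bar>x \<bullet> i\<bar>) < (\<Sum>i\<in>(Basis :: 'a set). norm x / DIM('a))"
    by (intro sum_strict_mono) auto
  then show False using norm_le_l1[of x] by simp
qed

lemma norm_add_scaleR_ge:
  fixes x e :: "'a::real_inner"
  assumes "norm e = 1" "0 \<le> t" "c * norm x \<le> x \<bullet> e" "c \<le> 1"
  shows "norm x + c * t \<le> norm (x + t *\<^sub>R e)"
proof (cases "x = 0")
  case True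
  then show ?thesis using assms mult_right_mono[of c 1 t] by simp
next
  case False
  have "norm x * (norm x + c * t) = norm x * norm x + t * (c * norm x)" by (simp add: algebra_simps)
  also have "\<dots> \<le> norm x * norm x + t * (x \<bullet> e)" using assms by (intro add_left_mono mult_left_mono) auto
  also have "\<dots> = x \<bullet> (x + t *\<^sub>R e)"
    by (simp add: inner_add_right power2_norm_eq_inner flip: power2_eq_square)
  also have "\<dots> \<le> norm x * norm (x + t *\<^sub>R e)" by (rule norm_cauchy_schwarz)
  finally show ?thesis using False by simp
qed

text \<open>From \<open>x\<close>, follow the coordinate direction in which the distance to the origin grows at least at rate
  \<open>1 / DIM('a)\<close>. Along this half-line the weight gains a factor \<open>exp (c * t)\<close> with \<open>c = k / DIM('a)\<close>, so the
  weight at \<open>x\<close> is bounded by \<open>exp (- (c * t))\<close> times the weight at the point reached at time \<open>t\<close>.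
  Since the chosen direction depends on \<open>x\<close>, the bound is summed over all \<open>2 * DIM('a)\<close> signed
  coordinate directions. Integrating over \<open>x\<close> first, by translation invariance each direction
  contributes the integral of \<open>exp (- (c * t))\<close>, that is \<open>1 / c\<close>, times the mixed energy.\<close>

lemma weighted_poincare:
  fixes p k :: real and \<phi> w :: "'a::euclidean_space \<Rightarrow> real"
  assumes \<phi>: "C1_supported R \<phi>" and w: "continuous_on UNIV w" "\<And>x. 0 < w x" and p: "1 < p" and k: "0 < k"
    and growth: "\<And>x y. norm x \<le> norm y \<Longrightarrow> norm y < R \<Longrightarrow> w x * exp (k * (norm y - norm x)) \<le> w y"
  shows "enn2real (power_energy w p \<phi>) powr (1 / p)
      \<le> 2 * (real DIM('a))\<^sup>2 * p / k * enn2real (grad_energy w p R \<phi>) powr (1 / p)"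
proof -
  note cont = w(1) C1_supportedD(2,4)[OF \<phi>]
  have [measurable]: "w \<in> borel_measurable borel" "\<phi> \<in> borel_measurable borel"
      "grad \<phi> \<in> borel_measurable borel"
    using cont by (auto intro: borel_measurable_continuous_onI)
  define c where "c = k / DIM('a)"
  have c: "0 < c" using k by (simp add: c_def)
  define \<Phi> where "\<Phi> y = p * \<bar>\<phi> y\<bar> powr (p - 1) * norm (grad \<phi> y)" for y
  have \<Phi>0: "0 \<le> \<Phi> y" for y using p by (simp add: \<Phi>_def)
  have [measurable]: "\<Phi> \<in> borel_measurable borel" unfolding \<Phi>_def by measurable
  define F where "F y = ennreal (w y * \<Phi> y)" for y
  have [measurable]: "F \<in> borel_measurable borel" unfolding F_def by measurable
  define E where "E t = ennreal (exp (- (c * t))) * indicator {0..} t" for t :: real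
  have [measurable]: "E \<in> borel_measurable borel" unfolding E_def by measurable
  define D where "D = (Basis :: 'a set) \<times> {1, -1 :: real}"
  have D: "finite D" "card D = 2 * DIM('a)" by (auto simp: D_def card_cartesian_product)
  let ?e = "\<lambda>d :: 'a \<times> real. snd d *\<^sub>R fst d"
  have pointwise: "ennreal (w x * \<bar>\<phi> x\<bar> powr p) \<le> (\<Sum>d\<in>D. \<integral>\<^sup>+t. E t * F (x + t *\<^sub>R ?e d) \<partial>lborel)" for x
  proof -
    obtain i :: 'a where i: "i \<in> Basis" "norm x / DIM('a) \<le> \<bar>x \<bullet> i\<bar>"
      using ex_Basis_coordinate_ge by blast
    define s :: real where "s = (if x \<bullet> i \<ge> 0 then 1 else -1)"
    define e where "e = s *\<^sub>R i"
    have e: "norm e = 1" "1 / DIM('a) * norm x \<le> x \<bullet> e" "(i, s) \<in> D"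
      using i by (auto simp: e_def s_def D_def)
    \<comment> \<open>Outside the ball the growth condition is silent, but there \<open>\<Phi>\<close> vanishes.\<close>
    have step: "w x * \<Phi> (x + t *\<^sub>R e) \<le> exp (- (c * t)) * (w (x + t *\<^sub>R e) * \<Phi> (x + t *\<^sub>R e))"
      if t: "0 \<le> t" for t
    proof (cases "norm (x + t *\<^sub>R e) < R")
      case True
      have n: "norm x + 1 / DIM('a) * t \<le> norm (x + t *\<^sub>R e)"
        using e t by (intro norm_add_scaleR_ge) (auto simp: Suc_le_eq)
      then have le: "norm x \<le> norm (x + t *\<^sub>R e)"
        using t by (smt (verit) divide_nonneg_nonneg mult_nonneg_nonneg of_nat_0_le_iff zero_le_one)
      have "c * t \<le> k * (norm (x + t *\<^sub>R e) - norm x)"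
        using n k mult_left_mono[of "1 / DIM('a) * t" "norm (x + t *\<^sub>R e) - norm x" k] by (simp add: c_def)
      then have "w x * exp (c * t) \<le> w x * exp (k * (norm (x + t *\<^sub>R e) - norm x))"
        using w(2)[of x] by simp
      also have "\<dots> \<le> w (x + t *\<^sub>R e)" by (rule growth[OF le True])
      finally have "w x \<le> exp (- (c * t)) * w (x + t *\<^sub>R e)"
        by (simp add: exp_minus field_simps)
      then show ?thesis using \<Phi>0 mult_right_mono by (fastforce simp: mult.assoc[symmetric])
    next
      case False
      then have "\<Phi> (x + t *\<^sub>R e) = 0" by (simp add: \<Phi>_def C1_supportedD(3)[OF \<phi>])
      then show ?thesis by simp
    qed
    have "ennreal (w x * \<bar>\<phi> x\<bar> powr p) = ennreal (w x) * ennreal (\<bar>\<phi> x\<bar> powr p)"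
      by (simp add: ennreal_mult' less_imp_le[OF w(2)])
    also have "\<dots> \<le> ennreal (w x) * (\<integral>\<^sup>+t. ennreal (\<Phi> (x + t *\<^sub>R e)) * indicator {0..} t \<partial>lborel)"
      using C1_supported_le_half_line[OF \<phi> p e(1), of x] by (intro mult_left_mono) (auto simp: \<Phi>_def)
    also have "\<dots> = (\<integral>\<^sup>+t. ennreal (w x * \<Phi> (x + t *\<^sub>R e)) * indicator {0..} t \<partial>lborel)"
      by (subst nn_integral_cmult[symmetric])
         (auto intro!: nn_integral_cong simp: ennreal_mult'' \<Phi>0 mult.assoc)
    also have "\<dots> \<le> (\<integral>\<^sup>+t. E t * F (x + t *\<^sub>R e) \<partial>lborel)"
      unfolding E_def F_def
      by (intro nn_integral_mono) (auto split: split_indicator simp: step intro!: ennreal_leI simp flip: ennreal_mult')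
    also have "\<dots> = (\<integral>\<^sup>+t. E t * F (x + t *\<^sub>R ?e (i, s)) \<partial>lborel)" by (simp add: e_def)
    also have "\<dots> \<le> (\<Sum>d\<in>D. \<integral>\<^sup>+t. E t * F (x + t *\<^sub>R ?e d) \<partial>lborel)"
      by (rule member_le_sum[where f="\<lambda>d. \<integral>\<^sup>+t. E t * F (x + t *\<^sub>R ?e d) \<partial>lborel", OF e(3) _ D(1)]) simp
    finally show ?thesis .
  qed
  have one: "(\<integral>\<^sup>+x. \<integral>\<^sup>+t. E t * F (x + t *\<^sub>R e) \<partial>lborel \<partial>lborel) = ennreal (1 / c) * (\<integral>\<^sup>+x. F x \<partial>lborel)" for e
  proof -
    have "(\<integral>\<^sup>+x. \<integral>\<^sup>+t. E t * F (x + t *\<^sub>R e) \<partial>lborel \<partial>lborel)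
        = (\<integral>\<^sup>+t. \<integral>\<^sup>+x. E t * F (x + t *\<^sub>R e) \<partial>lborel \<partial>lborel)"
      by (rule lborel_pair.Fubini') measurable
    also have "\<dots> = (\<integral>\<^sup>+t. E t * (\<integral>\<^sup>+x. F x \<partial>lborel) \<partial>lborel)"
      by (simp add: nn_integral_cmult nn_integral_lborel_translate)
    also have "\<dots> = (\<integral>\<^sup>+t. E t \<partial>lborel) * (\<integral>\<^sup>+x. F x \<partial>lborel)"
      by (rule nn_integral_multc) measurable
    finally show ?thesis unfolding E_def nn_integral_lborel_exp_half_line[OF c] .
  qed
  have "power_energy w p \<phi> \<le> (\<integral>\<^sup>+x. (\<Sum>d\<in>D. \<integral>\<^sup>+t. E t * F (x + t *\<^sub>R ?e d) \<partial>lborel) \<partial>lborel)"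
    unfolding power_energy_def by (intro nn_integral_mono pointwise)
  also have "\<dots> = (\<Sum>d\<in>D. \<integral>\<^sup>+x. \<integral>\<^sup>+t. E t * F (x + t *\<^sub>R ?e d) \<partial>lborel \<partial>lborel)"
    by (rule nn_integral_sum) measurable
  also have "\<dots> = ennreal (2 * DIM('a) / c) * (\<integral>\<^sup>+x. F x \<partial>lborel)"
  proof -
    have "of_nat (2 * DIM('a)) * ennreal (1 / c) = ennreal (2 * DIM('a) / c)"
      using c by (simp add: ennreal_of_nat_eq_real_of_nat less_imp_le flip: ennreal_mult)
    then show ?thesis unfolding one sum_constant D(2) mult.assoc[symmetric] by simp
  qed
  also have "\<dots> \<le> ennreal (2 * DIM('a) / c) * (ennreal p *
      (epow (power_energy w p \<phi>) (1 - 1 / p) * epow (grad_energy w p R \<phi>) (1 / p)))"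
    unfolding F_def \<Phi>_def
    by (intro mult_left_mono mixed_energy_le[OF \<phi> w p p]) (use p in \<open>auto simp: field_simps\<close>)
  finally have main: "power_energy w p \<phi> \<le> ennreal (2 * DIM('a) / c) * (ennreal p *
      (epow (power_energy w p \<phi>) (1 - 1 / p) * epow (grad_energy w p R \<phi>) (1 / p)))" .
  define a where "a = enn2real (power_energy w p \<phi>)"
  define b where "b = enn2real (grad_energy w p R \<phi>)"
  have a: "power_energy w p \<phi> = ennreal a" "0 \<le> a"
    using power_energy_finite[OF \<phi> w(1) less_imp_le[OF w(2)], of p] p by (auto simp: a_def less_top)
  have b: "grad_energy w p R \<phi> = ennreal b" "0 \<le> b"
    using grad_energy_finite[OF \<phi> w(1) less_imp_le[OF w(2)], of p] p by (auto simp: b_def less_top)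
  have "ennreal a \<le> ennreal (2 * DIM('a) / c * (p * (a powr (1 - 1 / p) * b powr (1 / p))))"
    using main a b p c by (simp add: ennreal_mult' less_imp_le flip: ennreal_mult')
  then have "a powr 1 \<le> a powr (1 - 1 / p) * (2 * DIM('a) / c * p * b powr (1 / p))"
    using a b p c by (subst (asm) ennreal_le_iff) (auto simp: mult_ac)
  then have "a powr (1 - (1 - 1 / p)) \<le> 2 * DIM('a) / c * p * b powr (1 / p)"
    using a b p c by (intro powr_absorb) auto
  then show ?thesis by (simp add: a_def b_def c_def power2_eq_square)
qed

text \<open>The Gagliardo-Nirenberg argument for \<open>\<bar>\<phi>\<bar> powr \<gamma>\<close>. On each coordinate line through \<open>x\<close> the half-line
  pointing away from the origin is used, where the weight is at least \<open>w x\<close>. The product of the line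
  bounds produces the power \<open>n / (n - 1)\<close> of the weight, which dominates the weight itself because
  \<open>w \<ge> 1\<close>. The exponent \<open>\<gamma>\<close> is the one for which both \<open>\<gamma> * (n / (n - 1))\<close> and the Hoelder exponent
  of the mixed energy equal the critical exponent \<open>m\<close>.\<close>

lemma weighted_sobolev:
  fixes p :: real and \<phi> w :: "'a::euclidean_space \<Rightarrow> real"
  assumes \<phi>: "C1_supported R \<phi>" and w: "continuous_on UNIV w" "\<And>x. 1 \<le> w x"
    and mono: "\<And>x y. norm x \<le> norm y \<Longrightarrow> w x \<le> w y"
    and p: "1 < p" "p < DIM('a)" and m: "1 / m = 1 / p - 1 / DIM('a)"
  shows "enn2real (power_energy w m \<phi>) powr (1 / m)
      \<le> p * (real DIM('a) - 1) / (real DIM('a) - p) * enn2real (grad_energy w p R \<phi>) powr (1 / p)"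
proof -
  define n where "n = real DIM('a)"
  define \<gamma> where "\<gamma> = p * (n - 1) / (n - p)"
  have n: "p < n" "1 < n" "1 < DIM('a)" using p by (auto simp: n_def)
  have dim: "real (DIM('a) - 1) = n - 1" using n by (simp add: n_def of_nat_diff)
  have "1 / m = (n - p) / (n * p)" using m p n by (simp add: n_def field_simps)
  then have "1 / (1 / m) = n * p / (n - p)" by simp
  then have m_eq: "m = n * p / (n - p)" by simp
  have m0: "0 < m" using p n by (simp add: m_eq)
  have \<gamma>1: "1 < \<gamma>"
  proof -
    have "n - p < p * (n - 1)" using p n mult_strict_right_mono[of 1 p n] by (simp add: algebra_simps)
    then show ?thesis using n by (simp add: \<gamma>_def field_simps)
  qed
  have \<gamma>m: "\<gamma> - 1 = m * (1 - 1 / p)" "\<gamma> * (n / (n - 1)) = m"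
  proof -
    have "\<gamma> - 1 = (n * p - n) / (n - p)" using n by (simp add: \<gamma>_def field_simps)
    also have "\<dots> = m * (1 - 1 / p)"
    proof -
      have "m * (1 - 1 / p) = n * p / (n - p) * ((p - 1) / p)"
        using p by (simp add: m_eq diff_divide_distrib)
      also have "\<dots> = n * (p - 1) / (n - p)" using p by simp
      finally show ?thesis by (simp add: right_diff_distrib)
    qed
    finally show "\<gamma> - 1 = m * (1 - 1 / p)" .
    show "\<gamma> * (n / (n - 1)) = m" using n by (simp add: \<gamma>_def m_eq)
  qed
  have root_pow: "y powr (n / (n - 1)) = (y powr (1 / (n - 1))) ^ DIM('a)" for y :: real
    by (cases "y = 0") (auto simp: powr_power n_def)
  have w0: "0 < w x" for x using w(2)[of x] by simp
  note cont = w(1) C1_supportedD(2,4)[OF \<phi>]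
  have [measurable]: "w \<in> borel_measurable borel" "\<phi> \<in> borel_measurable borel"
      "grad \<phi> \<in> borel_measurable borel"
    using cont by (auto intro: borel_measurable_continuous_onI)
  define \<Phi> where "\<Phi> y = \<gamma> * \<bar>\<phi> y\<bar> powr (\<gamma> - 1) * norm (grad \<phi> y)" for y
  have \<Phi>0: "0 \<le> \<Phi> y" for y using \<gamma>1 by (simp add: \<Phi>_def)
  have [measurable]: "\<Phi> \<in> borel_measurable borel" unfolding \<Phi>_def by measurable
  define F where "F y = ennreal (w y * \<Phi> y)" for y
  have [measurable]: "F \<in> borel_measurable borel" unfolding F_def by measurable
  have line: "ennreal (w x * \<bar>\<phi> x\<bar> powr \<gamma>) \<le> (\<integral>\<^sup>+t. F (x + t *\<^sub>R i) \<partial>lborel)" if i: "i \<in> Basis" for x i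
  proof -
    define s :: real where "s = (if x \<bullet> i \<ge> 0 then 1 else -1)"
    define e where "e = s *\<^sub>R i"
    have e: "norm e = 1" "0 \<le> x \<bullet> e"
      using i by (auto simp: e_def s_def)
    have step: "w x * \<Phi> (x + t *\<^sub>R e) \<le> w (x + t *\<^sub>R e) * \<Phi> (x + t *\<^sub>R e)" if t: "0 \<le> t" for t
    proof -
      have "norm x \<le> norm (x + t *\<^sub>R e)"
        using norm_add_scaleR_ge[OF e(1) t, of 0 x] e by simp
      then show ?thesis by (intro mult_right_mono mono \<Phi>0)
    qed
    have "ennreal (w x * \<bar>\<phi> x\<bar> powr \<gamma>) = ennreal (w x) * ennreal (\<bar>\<phi> x\<bar> powr \<gamma>)"
      by (simp add: ennreal_mult' less_imp_le[OF w0])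
    also have "\<dots> \<le> ennreal (w x) * (\<integral>\<^sup>+t. ennreal (\<Phi> (x + t *\<^sub>R e)) * indicator {0..} t \<partial>lborel)"
      using C1_supported_le_half_line[OF \<phi> \<gamma>1 e(1), of x] by (intro mult_left_mono) (auto simp: \<Phi>_def)
    also have "\<dots> = (\<integral>\<^sup>+t. ennreal (w x * \<Phi> (x + t *\<^sub>R e)) * indicator {0..} t \<partial>lborel)"
      by (subst nn_integral_cmult[symmetric])
         (auto intro!: nn_integral_cong simp: ennreal_mult'' \<Phi>0 mult.assoc)
    also have "\<dots> \<le> (\<integral>\<^sup>+t. F (x + t *\<^sub>R e) \<partial>lborel)"
      unfolding F_def
      by (intro nn_integral_mono) (auto split: split_indicator simp: step intro!: ennreal_leI)
    also have "\<dots> = (\<integral>\<^sup>+t. F (x + (0 + s * t) *\<^sub>R i) \<partial>lborel)"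
      by (simp add: e_def mult.commute)
    also have "\<dots> = (\<integral>\<^sup>+t. F (x + t *\<^sub>R i) \<partial>lborel)"
      by (subst (2) nn_integral_real_affine[where c=s and t=0]) (auto simp: s_def)
    finally show ?thesis .
  qed
  have "power_energy w m \<phi> \<le> epow (\<integral>\<^sup>+x. F x \<partial>lborel) (1 / real (DIM('a) - 1)) ^ DIM('a)"
    unfolding power_energy_def
  proof (rule nn_integral_le_product_of_line_integrals)
    fix x
    let ?y = "w x * \<bar>\<phi> x\<bar> powr \<gamma>"
    have y0: "0 \<le> ?y" using w0[of x] by simp
    have "w x powr 1 \<le> w x powr (n / (n - 1))"
      using w(2)[of x] n by (intro powr_mono) (auto simp: field_simps)
    then have "w x * \<bar>\<phi> x\<bar> powr m \<le> w x powr (n / (n - 1)) * \<bar>\<phi> x\<bar> powr (\<gamma> * (n / (n - 1)))"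
      unfolding \<gamma>m(2) using w0[of x] by (intro mult_right_mono) auto
    also have "\<dots> = ?y powr (n / (n - 1))"
      using w0[of x] by (simp add: powr_mult powr_powr)
    also have "\<dots> = (?y powr (1 / (n - 1))) ^ DIM('a)"
      by (rule root_pow)
    finally have "ennreal (w x * \<bar>\<phi> x\<bar> powr m) \<le> ennreal ((?y powr (1 / (n - 1))) ^ DIM('a))"
      by (rule ennreal_leI)
    also have "\<dots> = (\<Prod>i\<in>(Basis :: 'a set). epow (ennreal ?y) (1 / real (DIM('a) - 1)))"
      by (simp add: dim epow_ennreal[OF y0] ennreal_power flip: n_def)
    also have "\<dots> \<le> (\<Prod>i\<in>Basis. epow (\<integral>\<^sup>+t. F (x + t *\<^sub>R i) \<partial>lborel) (1 / real (DIM('a) - 1)))"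
      by (intro prod_mono_ennreal epow_mono line) auto
    finally show "ennreal (w x * \<bar>\<phi> x\<bar> powr m)
        \<le> (\<Prod>i\<in>Basis. epow (\<integral>\<^sup>+t. F (x + t *\<^sub>R i) \<partial>lborel) (1 / real (DIM('a) - 1)))" .
  qed (use n in auto)
  also have "\<dots> \<le> epow (ennreal \<gamma> * (epow (power_energy w m \<phi>) (1 - 1 / p)
      * epow (grad_energy w p R \<phi>) (1 / p))) (1 / real (DIM('a) - 1)) ^ DIM('a)"
    unfolding F_def \<Phi>_def
    by (intro power_mono epow_mono mixed_energy_le[OF \<phi> w(1) w0 p(1) \<gamma>1 \<gamma>m(1)]) auto
  finally have main: "power_energy w m \<phi> \<le> epow (ennreal \<gamma> * (epow (power_energy w m \<phi>) (1 - 1 / p)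
      * epow (grad_energy w p R \<phi>) (1 / p))) (1 / real (DIM('a) - 1)) ^ DIM('a)" .
  define a where "a = enn2real (power_energy w m \<phi>)"
  define b where "b = enn2real (grad_energy w p R \<phi>)"
  have a: "power_energy w m \<phi> = ennreal a" "0 \<le> a"
    using power_energy_finite[OF \<phi> w(1) less_imp_le[OF w0] m0] by (auto simp: a_def less_top)
  have b: "grad_energy w p R \<phi> = ennreal b" "0 \<le> b"
    using grad_energy_finite[OF \<phi> w(1) less_imp_le[OF w0], of p] p by (auto simp: b_def less_top)
  let ?z = "\<gamma> * (a powr (1 - 1 / p) * b powr (1 / p))"
  have z0: "0 \<le> ?z" using \<gamma>1 by simp
  have "ennreal \<gamma> * (epow (ennreal a) (1 - 1 / p) * epow (ennreal b) (1 / p)) = ennreal ?z"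
    using a b \<gamma>1 by (simp add: ennreal_mult')
  then have "ennreal a \<le> ennreal ((?z powr (1 / (n - 1))) ^ DIM('a))"
    using main z0 unfolding a b by (simp add: dim ennreal_power flip: n_def)
  then have "a \<le> (?z powr (1 / (n - 1))) ^ DIM('a)"
    by (subst (asm) ennreal_le_iff) auto
  also have "\<dots> = ?z powr (n / (n - 1))"
    by (rule root_pow[symmetric])
  finally have "a powr ((n - 1) / n) \<le> (?z powr (n / (n - 1))) powr ((n - 1) / n)"
    using a n by (intro powr_mono2) auto
  also have "\<dots> = ?z"
    using n z0 by (simp add: powr_powr)
  finally have "a powr ((n - 1) / n) \<le> a powr (1 - 1 / p) * (\<gamma> * b powr (1 / p))"
    by (simp add: mult_ac)
  moreover have "(n - 1) / n - (1 - 1 / p) = 1 / m"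
    using m n p by (simp add: n_def field_simps)
  moreover from this have "1 - 1 / p < (n - 1) / n"
    using m0 by (smt (verit) zero_less_divide_1_iff)
  ultimately have "a powr (1 / m) \<le> \<gamma> * b powr (1 / p)"
    using powr_absorb[of a "\<gamma> * b powr (1 / p)" "1 - 1 / p" "(n - 1) / n"] a \<gamma>1 by simp
  then show ?thesis by (simp add: a_def b_def \<gamma>_def n_def)
qed

text \<open>The exponent \<open>q\<close> lies between \<open>p\<close> and the critical exponent \<open>m\<close>; Hoelder interpolates the energy, and
  \<open>t\<close> is the weight of \<open>m\<close> in \<open>q = p * (1 - t) + m * t\<close>. The factor \<open>1 / \<kappa>\<close> enters only
  through the lower end, hence with the power \<open>p * (1 - t)\<close>.\<close>

lemma interpolation_power_energy:
  fixes p q m n \<kappa> K B :: real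
  assumes \<phi>: "C1_supported R \<phi>" and w: "continuous_on UNIV w" "\<And>x. 0 \<le> w x"
    and p: "1 < p" "p < n" and q: "p < q" "q < n * p / (n - p)" and m: "1 / m = 1 / p - 1 / n"
    and \<kappa>: "0 < \<kappa>" and K: "0 < K" and B: "0 \<le> B"
    and lower: "enn2real (power_energy w p \<phi>) powr (1 / p) \<le> K / \<kappa> * B"
    and upper: "enn2real (power_energy w m \<phi>) powr (1 / m) \<le> K * B"
  shows "power_energy w q \<phi> \<le> ennreal ((K * B * \<kappa> powr (n * (q - p) / (p * q) - 1)) powr q)"
proof -
  have "1 / m = (n - p) / (n * p)" using m p by (simp add: field_simps)
  then have "1 / (1 / m) = n * p / (n - p)" by simp
  then have m_eq: "m = n * p / (n - p)" by simp
  have qm: "q < m" using q m_eq by simp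
  define t where "t = (q - p) / (m - p)"
  have t: "0 < t" "t < 1" using q qm by (auto simp: t_def field_simps)
  have tq: "p * (1 - t) + m * t = q"
  proof -
    have "t * (m - p) = q - p" using q qm by (simp add: t_def)
    then show ?thesis by (simp add: algebra_simps)
  qed
  have "m - p = p\<^sup>2 / (n - p)"
    using p by (simp add: m_eq field_simps power2_eq_square)
  then have "t = (q - p) * (n - p) / p\<^sup>2" by (simp add: t_def)
  then have "p * t = (q - p) * (n - p) / p"
    using p by (simp add: power2_eq_square)
  then have "p * (1 - t) = p - (q - p) * (n - p) / p"
    by (simp only: right_diff_distrib mult_1_right)
  also have "\<dots> = - (n * (q - p) / (p * q) - 1) * q"
    using p q by (simp add: field_simps)
  finally have tx: "p * (1 - t) = - (n * (q - p) / (p * q) - 1) * q" .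
  have [measurable]: "w \<in> borel_measurable borel" "\<phi> \<in> borel_measurable borel"
    using w(1) C1_supportedD(4)[OF \<phi>] by (auto intro: borel_measurable_continuous_onI)
  define a where "a = enn2real (power_energy w p \<phi>)"
  define b where "b = enn2real (power_energy w m \<phi>)"
  have a: "power_energy w p \<phi> = ennreal a" "0 \<le> a"
    using power_energy_finite[OF \<phi> w, of p] p by (auto simp: a_def less_top)
  have b: "power_energy w m \<phi> = ennreal b" "0 \<le> b"
    using power_energy_finite[OF \<phi> w, of m] p q qm by (auto simp: b_def less_top)
  have "power_energy w q \<phi>
      = (\<integral>\<^sup>+x. epow (ennreal (w x * \<bar>\<phi> x\<bar> powr p)) (1 - t) * epow (ennreal (w x * \<bar>\<phi> x\<bar> powr m)) t \<partial>lborel)"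
    unfolding power_energy_def
  proof (rule nn_integral_cong)
    fix x
    have "(w x * \<bar>\<phi> x\<bar> powr p) powr (1 - t) * (w x * \<bar>\<phi> x\<bar> powr m) powr t
        = (w x powr (1 - t) * w x powr t) * (\<bar>\<phi> x\<bar> powr (p * (1 - t)) * \<bar>\<phi> x\<bar> powr (m * t))"
      using w(2)[of x] by (simp add: powr_mult powr_powr)
    also have "\<dots> = w x * \<bar>\<phi> x\<bar> powr q"
      using w(2)[of x] by (simp flip: powr_add add: tq)
    finally show "ennreal (w x * \<bar>\<phi> x\<bar> powr q)
        = epow (ennreal (w x * \<bar>\<phi> x\<bar> powr p)) (1 - t) * epow (ennreal (w x * \<bar>\<phi> x\<bar> powr m)) t"
      using w(2)[of x] by (simp flip: ennreal_mult')
  qed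
  also have "\<dots> \<le> epow (power_energy w p \<phi>) (1 - t) * epow (power_energy w m \<phi>) t"
    unfolding power_energy_def by (rule holder_nn_integral_two[OF t]) measurable
  also have "\<dots> = ennreal (a powr (1 - t) * b powr t)"
    using a b by (simp add: ennreal_mult')
  also have "\<dots> \<le> ennreal ((K * B * \<kappa> powr (n * (q - p) / (p * q) - 1)) powr q)"
  proof (rule ennreal_leI)
    have "a = (a powr (1 / p)) powr p" using a p by (simp add: powr_powr)
    also have "\<dots> \<le> (K / \<kappa> * B) powr p"
      using lower p by (intro powr_mono2) (auto simp: a_def)
    finally have "a powr (1 - t) \<le> (K / \<kappa> * B) powr (p * (1 - t))"
      using a t powr_mono2[of "1 - t" a "(K / \<kappa> * B) powr p"] by (simp add: powr_powr)
    moreover have "b = (b powr (1 / m)) powr m" using b p q qm by (simp add: powr_powr)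
    moreover have "\<dots> \<le> (K * B) powr m"
      using upper p q qm by (intro powr_mono2) (auto simp: b_def)
    ultimately have "a powr (1 - t) * b powr t \<le> (K / \<kappa> * B) powr (p * (1 - t)) * (K * B) powr (m * t)"
      using b t powr_mono2[of t b "(K * B) powr m"] by (intro mult_mono) (auto simp: powr_powr)
    also have "K / \<kappa> * B = (K * B) * (1 / \<kappa>)" by simp
    also have "((K * B) * (1 / \<kappa>)) powr (p * (1 - t)) = (K * B) powr (p * (1 - t)) * (1 / \<kappa>) powr (p * (1 - t))"
      by (rule powr_mult)
    also have "(1 / \<kappa>) powr (p * (1 - t)) = (\<kappa> powr (n * (q - p) / (p * q) - 1)) powr q"
    proof -
      have "(1 / \<kappa>) powr (p * (1 - t)) = \<kappa> powr (- (p * (1 - t)))"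
        using \<kappa> by (simp add: powr_divide powr_minus_divide)
      then show ?thesis by (simp only: tx powr_powr mult_minus_left minus_minus)
    qed
    also have "(K * B) powr (p * (1 - t)) * (\<kappa> powr (n * (q - p) / (p * q) - 1)) powr q * (K * B) powr (m * t)
        = ((K * B) powr (p * (1 - t)) * (K * B) powr (m * t)) * (\<kappa> powr (n * (q - p) / (p * q) - 1)) powr q"
      by (simp only: mult_ac)
    also have "(K * B) powr (p * (1 - t)) * (K * B) powr (m * t) = (K * B) powr q"
      by (simp flip: powr_add add: tq)
    also have "(K * B) powr q * (\<kappa> powr (n * (q - p) / (p * q) - 1)) powr q
        = (K * B * \<kappa> powr (n * (q - p) / (p * q) - 1)) powr q"
      using K B by (simp add: powr_mult)
    finally show "a powr (1 - t) * b powr t \<le> (K * B * \<kappa> powr (n * (q - p) / (p * q) - 1)) powr q" .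
  qed
  finally show ?thesis .
qed

section \<open>The weight\<close>

lemma weight_exponent_deriv:
  assumes "weight_exponent \<alpha>\<^sub>1 \<alpha>\<^sub>2 g" "0 < s"
  shows "(g has_real_derivative deriv g s) (at s)"
proof -
  have "g differentiable (at s)"
    using assms by (auto simp: weight_exponent_def C1_differentiable_on_eq)
  then show ?thesis by (simp add: DERIV_deriv_iff_real_differentiable)
qed

text \<open>By the upper bound on \<open>deriv g\<close>, the condition \<open>\<alpha>\<^sub>2 \<le> 1\<close> makes the derivative of \<open>g s / s\<close> nonpositive.\<close>

lemma weight_exponent_quotient_antimono:
  assumes g: "weight_exponent \<alpha>\<^sub>1 \<alpha>\<^sub>2 g" and \<alpha>: "\<alpha>\<^sub>2 \<le> 1" and s: "0 < s" "s \<le> R"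
  shows "g R / R \<le> g s / s"
proof (rule DERIV_nonpos_imp_nonincreasing[OF s(2)])
  fix x assume "s \<le> x" "x \<le> R"
  then have x: "0 < x" using s by simp
  have "((\<lambda>x. g x / x) has_real_derivative (deriv g x * x - g x * 1) / (x * x)) (at x)"
    using x by (intro DERIV_divide weight_exponent_deriv[OF g]) auto
  moreover have "(deriv g x * x - g x * 1) / (x * x) \<le> 0"
  proof -
    have "deriv g x \<le> \<alpha>\<^sub>2 * (g x / x)" "0 < g x" using g x by (auto simp: weight_exponent_def)
    moreover have "\<alpha>\<^sub>2 * (g x / x) \<le> 1 * (g x / x)"
      using \<alpha> x \<open>0 < g x\<close> by (intro mult_right_mono) auto
    ultimately have "deriv g x \<le> g x / x" by simp
    then have "deriv g x * x \<le> g x" using x by (simp add: pos_le_divide_eq)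
    then show ?thesis using x by (intro divide_nonpos_nonneg) auto
  qed
  ultimately show "\<exists>y. ((\<lambda>x. g x / x) has_real_derivative y) (at x) \<and> y \<le> 0" by blast
qed

text \<open>Since \<open>g s / s\<close> is nonincreasing, the lower bound on \<open>deriv g\<close> is uniform on \<open>{0<..R}\<close>: the slope is at least
  \<open>\<alpha>\<^sub>1 * (g R / R)\<close>. This is the exponential growth rate in the Poincare inequality.\<close>

lemma weight_exponent_growth:
  assumes g: "weight_exponent \<alpha>\<^sub>1 \<alpha>\<^sub>2 g" and \<alpha>: "0 < \<alpha>\<^sub>1" "\<alpha>\<^sub>2 \<le> 1"
    and rs: "0 \<le> r" "r \<le> s" "s \<le> R" "0 < R"
  shows "\<alpha>\<^sub>1 * (g R / R) * (s - r) \<le> g s - g r"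
proof (cases "r = s")
  case False
  then have "r < s" using rs by simp
  moreover have "continuous_on {r..s} g"
    using g rs by (auto simp: weight_exponent_def intro: continuous_on_subset)
  moreover have "g differentiable (at x)" if "r < x" for x
    using weight_exponent_deriv[OF g, of x] that rs by (auto simp: real_differentiable_def)
  ultimately obtain l z where z: "r < z" "z < s" "(g has_real_derivative l) (at z)" "g s - g r = (s - r) * l"
    using MVT[of r s g] by blast
  have "\<alpha>\<^sub>1 * (g R / R) \<le> \<alpha>\<^sub>1 * (g z / z)"
    using weight_exponent_quotient_antimono[OF g \<alpha>(2), of z R] z rs \<alpha> by (intro mult_left_mono) auto
  also have "\<dots> \<le> deriv g z" using g z rs by (auto simp: weight_exponent_def)
  also have "deriv g z = l" using z(3) by (rule DERIV_imp_deriv)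
  finally show ?thesis using z rs mult_right_mono[of "\<alpha>\<^sub>1 * (g R / R)" l "s - r"] by (simp add: mult.commute)
qed simp

lemma weight_exponent_strict_mono:
  assumes g: "weight_exponent \<alpha>\<^sub>1 \<alpha>\<^sub>2 g" and \<alpha>: "0 < \<alpha>\<^sub>1" "\<alpha>\<^sub>2 \<le> 1" and rs: "0 \<le> r" "r < s"
  shows "g r < g s"
proof -
  have "0 < g s" using g rs by (auto simp: weight_exponent_def)
  then have "0 < \<alpha>\<^sub>1 * (g s / s) * (s - r)" using \<alpha> rs by simp
  then show ?thesis using weight_exponent_growth[OF g \<alpha>, of r s s] rs by simp
qed

lemma weight_exponent_continuous:
  assumes "weight_exponent \<alpha>\<^sub>1 \<alpha>\<^sub>2 g"
  shows "continuous_on UNIV (\<lambda>x::'a::real_normed_vector. exp (g (norm x)))"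
proof -
  have "continuous_on {0..} g" using assms by (simp add: weight_exponent_def)
  then have "continuous_on UNIV (\<lambda>x::'a. g (norm x))"
    by (rule continuous_on_compose2) (auto intro: continuous_on_norm_id)
  then show ?thesis by (rule continuous_on_exp)
qed

text \<open>By the mean value theorem the average of \<open>g\<close> over \<open>{0..R}\<close> is \<open>g z\<close> for some \<open>z\<close> in the open interval, so
  that \<open>Lam g R = (g R - g z) / R\<close>. The strict lower bound matters because \<open>Lam g R\<close> is raised to a
  negative power.\<close>

lemma Lam_bounds:
  assumes g: "weight_exponent \<alpha>\<^sub>1 \<alpha>\<^sub>2 g" and \<alpha>: "0 < \<alpha>\<^sub>1" "\<alpha>\<^sub>2 \<le> 1" and R: "0 < R"
  shows "0 < Lam g R" "Lam g R \<le> g R / R"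
proof -
  define I where "I s = integral {0..s} g" for s
  have cont: "continuous_on {0..b} g" for b
    using g by (auto simp: weight_exponent_def intro: continuous_on_subset)
  have I: "(I has_real_derivative g s) (at s)" if "0 < s" for s
  proof -
    have "(I has_real_derivative g s) (at s within {0..s + 1})"
      unfolding I_def[abs_def] using that by (intro integral_has_real_derivative cont) auto
    then show ?thesis using that by (simp add: at_within_Icc_at)
  qed
  have "continuous_on {0..R} I"
    unfolding I_def[abs_def] by (intro indefinite_integral_continuous_1 integrable_continuous_interval cont)
  moreover have "I differentiable (at x)" if "0 < x" for x
    using I[OF that] by (auto simp: real_differentiable_def)
  ultimately obtain l z where z: "0 < z" "z < R" "(I has_real_derivative l) (at z)" "I R - I 0 = (R - 0) * l"
    using MVT[OF R, of I] by blast
  then have "l = g z" using I[OF z(1)] DERIV_unique by blast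
  then have IR: "I R = R * g z" using z(4) by (simp add: I_def)
  have gz: "0 < g z" "g z < g R"
    using weight_exponent_strict_mono[OF g \<alpha>, of z R] g z by (auto simp: weight_exponent_def)
  have "((\<lambda>s. I s / s) has_real_derivative (g R * R - I R * 1) / (R * R)) (at R)"
    using R by (intro DERIV_divide I) auto
  moreover have "avg g = (\<lambda>s. I s / s)" by (auto simp: avg_def I_def)
  ultimately have "Lam g R = (g R - g z) / R"
    using R by (simp add: Lam_def DERIV_imp_deriv IR) (simp add: field_simps)
  then show "0 < Lam g R" "Lam g R \<le> g R / R"
    using gz R by (auto simp: divide_right_mono)
qed

text \<open>The Poincare inequality with rate \<open>k = \<alpha>\<^sub>1 * (g R / R)\<close> and the Sobolev inequality are the two ends of
  the interpolation; \<open>K\<close> is any common bound for their constants, so it does not depend on \<open>q\<close>.\<close>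

lemma weighted_gagliardo_nirenberg:
  fixes p q n K \<alpha>\<^sub>1 \<alpha>\<^sub>2 R :: real and \<phi> :: "'a::euclidean_space \<Rightarrow> real"
  defines "n \<equiv> real DIM('a)"
  assumes g: "weight_exponent \<alpha>\<^sub>1 \<alpha>\<^sub>2 g" and \<alpha>: "0 < \<alpha>\<^sub>1" "\<alpha>\<^sub>2 \<le> 1" and R: "0 < R"
    and p: "1 < p" "p < n" and q: "p < q" "q < n * p / (n - p)"
    and \<phi>: "C1_supported R \<phi>"
    and K: "2 * n\<^sup>2 * p / \<alpha>\<^sub>1 \<le> K" "p * (n - 1) / (n - p) \<le> K"
  shows "power_energy (\<lambda>x. exp (g (norm x))) q \<phi>
      \<le> ennreal ((K * enn2real (grad_energy (\<lambda>x. exp (g (norm x))) p R \<phi>) powr (1 / p)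
            * (g R / R) powr (n * (q - p) / (p * q) - 1)) powr q)"
proof -
  define w where "w x = exp (g (norm x))" for x :: 'a
  define B where "B = enn2real (grad_energy w p R \<phi>) powr (1 / p)"
  define m where "m = n * p / (n - p)"
  have m: "1 / m = 1 / p - 1 / n" using p by (simp add: m_def field_simps)
  have w: "continuous_on UNIV w" using weight_exponent_continuous[OF g] by (simp add: w_def[abs_def])
  have gR: "0 < g R" using g R by (auto simp: weight_exponent_def)
  have gmono: "g r \<le> g s" if "0 \<le> r" "r \<le> s" for r s
    using weight_exponent_strict_mono[OF g \<alpha>, of r s] that by (cases "r = s") auto
  have w1: "1 \<le> w x" for x
    using gmono[of 0 "norm x"] g by (simp add: w_def weight_exponent_def)
  have B: "0 \<le> B" by (simp add: B_def)
  have K0: "0 < K"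
    using K(1) p \<alpha> by (smt (verit) divide_pos_pos mult_pos_pos zero_less_power)
  have growth: "w x * exp (\<alpha>\<^sub>1 * (g R / R) * (norm y - norm x)) \<le> w y"
    if "norm x \<le> norm y" "norm y < R" for x y
    using weight_exponent_growth[OF g \<alpha>, of "norm x" "norm y" R] that R
    by (simp add: w_def flip: exp_add)
  have "enn2real (power_energy w p \<phi>) powr (1 / p) \<le> 2 * n\<^sup>2 * p / (\<alpha>\<^sub>1 * (g R / R)) * B"
    unfolding B_def n_def using w1 growth gR R \<alpha> p
    by (intro weighted_poincare[OF \<phi> w]) (auto simp: w_def)
  also have "\<dots> = 2 * n\<^sup>2 * p / \<alpha>\<^sub>1 / (g R / R) * B" by simp
  also have "\<dots> \<le> K / (g R / R) * B"
    using K(1) gR R B by (intro mult_right_mono divide_right_mono) auto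
  finally have lower: "enn2real (power_energy w p \<phi>) powr (1 / p) \<le> K / (g R / R) * B" .
  have "enn2real (power_energy w m \<phi>) powr (1 / m) \<le> p * (n - 1) / (n - p) * B"
    unfolding B_def n_def using m p
    by (intro weighted_sobolev[OF \<phi> w w1]) (auto simp: n_def w_def gmono)
  also have "\<dots> \<le> K * B" using K(2) B by (rule mult_right_mono)
  finally have upper: "enn2real (power_energy w m \<phi>) powr (1 / m) \<le> K * B" .
  have "power_energy w q \<phi> \<le> ennreal ((K * B * (g R / R) powr (n * (q - p) / (p * q) - 1)) powr q)"
    using gR R by (intro interpolation_power_energy[OF \<phi> w _ p q m _ K0 B lower upper]) (auto simp: w_def)
  then show ?thesis by (simp add: B_def w_def[abs_def])
qed

section \<open>Passage from test functions to Sobolev functions\<close>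

text \<open>A substitute for Minkowski's inequality that is good enough where constants do not matter.\<close>

lemma powr_norm_add_le:
  fixes x y :: "'a::real_normed_vector"
  assumes "0 < p"
  shows "norm (x + y) powr p \<le> 2 powr p * (norm x powr p + norm y powr p)"
proof -
  have "norm (x + y) \<le> 2 * max (norm x) (norm y)"
    using norm_triangle_ineq[of x y] by linarith
  then have "norm (x + y) powr p \<le> (2 * max (norm x) (norm y)) powr p"
    using assms by (intro powr_mono2) auto
  also have "\<dots> = 2 powr p * max (norm x) (norm y) powr p"
    by (simp add: powr_mult)
  also have "max (norm x) (norm y) powr p \<le> norm x powr p + norm y powr p"
    by (simp add: max_def)
  finally show ?thesis by simp
qed

lemma set_integrable_powr_norm_diff:
  fixes f h :: "'a::euclidean_space \<Rightarrow> 'b::euclidean_space"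
  assumes p: "0 < p" and f: "f \<in> Lp p (ball 0 R)" and h: "continuous_on UNIV h"
  shows "set_integrable lebesgue (ball 0 R) (\<lambda>x. norm (f x - h x) powr p)"
proof -
  have fm: "(\<lambda>x. indicator (ball 0 R) x *\<^sub>R f x) \<in> borel_measurable lebesgue"
    and fi: "set_integrable lebesgue (ball 0 R) (\<lambda>x. norm (f x) powr p)"
    using f by (auto simp: Lp_def set_borel_measurable_def)
  have "set_integrable lborel (cball 0 R) (\<lambda>x. norm (h x) powr p)"
    unfolding set_integrable_def using p
    by (intro borel_integrable_compact continuous_on_powr' continuous_on_norm continuous_on_subset[OF h]) auto
  then have "set_integrable lborel (ball 0 R) (\<lambda>x. norm (h x) powr p)"
    by (rule set_integrable_subset) auto
  then have hi: "set_integrable lebesgue (ball 0 R) (\<lambda>x. norm (h x) powr p)"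
    unfolding set_integrable_def by (subst integrable_completion) auto
  have hm: "h \<in> borel_measurable lebesgue"
    using borel_measurable_continuous_onI[OF h] by (auto intro: measurable_completion)
  have ball: "ball 0 R \<in> sets (lebesgue :: 'a measure)" by (intro sets_completionI_sets) auto
  show ?thesis
  proof (rule set_integrable_bound)
    show "set_integrable lebesgue (ball 0 R) (\<lambda>x. 2 powr p * (norm (f x) powr p + norm (h x) powr p))"
      using fi hi by auto
    have "(\<lambda>x. norm (indicator (ball 0 R) x *\<^sub>R f x - indicator (ball 0 R) x *\<^sub>R h x) powr p) \<in> borel_measurable lebesgue"
      using fm hm ball by measurable
    also have "(\<lambda>x. norm (indicator (ball 0 R) x *\<^sub>R f x - indicator (ball 0 R) x *\<^sub>R h x) powr p)
        = (\<lambda>x. indicator (ball 0 R) x *\<^sub>R norm (f x - h x) powr p)"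
      by (auto simp: fun_eq_iff split: split_indicator)
    finally show "set_borel_measurable lebesgue (ball 0 R) (\<lambda>x. norm (f x - h x) powr p)"
      by (simp add: set_borel_measurable_def)
    show "AE x in lebesgue. x \<in> ball 0 R \<longrightarrow>
        norm (norm (f x - h x) powr p) \<le> norm (2 powr p * (norm (f x) powr p + norm (h x) powr p))"
      using powr_norm_add_le[OF p, of "f _" "- h _"] by (intro AE_I2) simp
  qed
qed

text \<open>Along a subsequence the test functions converge almost everywhere as well, which makes Fatou's lemma
  applicable.\<close>

lemma W1_0_approximation:
  fixes v :: "'a::euclidean_space \<Rightarrow> real"
  assumes p: "1 < p" and v: "v \<in> W1_0 p (ball 0 R)"
  obtains \<phi> where "\<And>k::nat. C1_supported R (\<phi> k)"
    and "AE x in lebesgue. x \<in> ball 0 R \<longrightarrow> (\<lambda>k. \<phi> k x) \<longlonglongrightarrow> v x"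
    and "(\<lambda>k. LINT x:ball 0 R|lebesgue. norm (weak_grad (ball 0 R) v x - grad (\<phi> k) x) powr p) \<longlonglongrightarrow> 0"
proof -
  let ?\<Omega> = "ball 0 R :: 'a set"
  obtain \<psi> where \<psi>: "\<And>k::nat. test_function ?\<Omega> (\<psi> k)"
    and lim: "(\<lambda>k. LINT x:?\<Omega>|lebesgue. \<bar>v x - \<psi> k x\<bar> powr p) \<longlonglongrightarrow> 0"
    and lim': "(\<lambda>k. LINT x:?\<Omega>|lebesgue. norm (weak_grad ?\<Omega> v x - grad (\<psi> k) x) powr p) \<longlonglongrightarrow> 0"
    and vLp: "v \<in> Lp p ?\<Omega>"
    using v by (auto simp: W1_0_def W1_def)
  have C1: "C1_supported R (\<psi> k)" for k
    by (rule test_function_imp_C1_supported[OF \<psi>])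
  define u where "u k x = indicator ?\<Omega> x *\<^sub>R (\<bar>v x - \<psi> k x\<bar> powr p)" for k x
  have "integrable lebesgue (u k)" for k
    using set_integrable_powr_norm_diff[OF _ vLp C1_supportedD(4)[OF C1[of k]]] p
    by (simp add: set_integrable_def u_def[abs_def])
  moreover have "(\<lambda>k. LINT x|lebesgue. norm (u k x)) \<longlonglongrightarrow> 0"
    using lim by (simp add: set_lebesgue_integral_def u_def[abs_def] abs_mult)
  ultimately obtain r :: "nat \<Rightarrow> nat" where r: "strict_mono r" "AE x in lebesgue. (\<lambda>k. u (r k) x) \<longlonglongrightarrow> 0"
    using tendsto_L1_AE_subseq[of lebesgue u] by blast
  from r(2) have ae: "AE x in lebesgue. x \<in> ?\<Omega> \<longrightarrow> (\<lambda>k. \<psi> (r k) x) \<longlonglongrightarrow> v x"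
  proof (rule AE_mp, intro AE_I2 impI)
    fix x assume "(\<lambda>k. u (r k) x) \<longlonglongrightarrow> 0" "x \<in> ?\<Omega>"
    then have "(\<lambda>k. \<bar>v x - \<psi> (r k) x\<bar> powr p) \<longlonglongrightarrow> 0" by (simp add: u_def)
    then have "(\<lambda>k. (\<bar>v x - \<psi> (r k) x\<bar> powr p) powr (1 / p)) \<longlonglongrightarrow> 0"
      by (rule tendsto_zero_powrI[OF _ tendsto_const]) (use p in auto)
    then have "(\<lambda>k. \<bar>v x - \<psi> (r k) x\<bar>) \<longlonglongrightarrow> 0"
      using p by (simp add: powr_powr)
    then have "(\<lambda>k. v x - (v x - \<psi> (r k) x)) \<longlonglongrightarrow> v x - 0"
      by (intro tendsto_intros) (simp add: tendsto_rabs_zero_iff)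
    then show "(\<lambda>k. \<psi> (r k) x) \<longlonglongrightarrow> v x" by simp
  qed
  show ?thesis
    using that[of "\<lambda>k. \<psi> (r k)"] C1 ae LIMSEQ_subseq_LIMSEQ[OF lim' r(1)] by (auto simp: o_def)
qed

lemma nn_integral_weighted_measure:
  fixes g :: "real \<Rightarrow> real" and h :: "'a::euclidean_space \<Rightarrow> real"
  assumes w: "continuous_on UNIV (\<lambda>x::'a. exp (g (norm x)))"
    and h: "(\<lambda>x. indicator S x *\<^sub>R h x) \<in> borel_measurable lebesgue"
  shows "(\<integral>\<^sup>+x. ennreal (indicator S x *\<^sub>R h x) \<partial>weighted_measure g)
      = (\<integral>\<^sup>+x. ennreal (exp (g (norm x)) * h x) * indicator S x \<partial>lebesgue)"
proof -
  have wm: "(\<lambda>x::'a. ennreal (exp (g (norm x)))) \<in> borel_measurable lebesgue"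
    using borel_measurable_continuous_onI[OF w] by (auto intro: measurable_completion)
  have "(\<lambda>x. ennreal (indicator S x *\<^sub>R h x)) \<in> borel_measurable lebesgue"
    by (rule measurable_compose[OF h measurable_ennreal])
  from nn_integral_density[OF wm this] show ?thesis
    unfolding weighted_measure_def
    by (auto intro!: nn_integral_cong split: split_indicator simp: ennreal_mult')
qed

lemma set_integrable_weighted_measure:
  fixes g :: "real \<Rightarrow> real" and h :: "'a::euclidean_space \<Rightarrow> real"
  assumes w: "continuous_on UNIV (\<lambda>x::'a. exp (g (norm x)))"
    and h: "(\<lambda>x. indicator S x *\<^sub>R h x) \<in> borel_measurable lebesgue" "\<And>x. 0 \<le> h x"
    and le: "(\<integral>\<^sup>+x. ennreal (exp (g (norm x)) * h x) * indicator S x \<partial>lebesgue) \<le> ennreal Z" "0 \<le> Z"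
  shows "set_integrable (weighted_measure g) S h"
    and "(LINT x:S|weighted_measure g. h x) \<le> Z"
    and "ennreal (LINT x:S|weighted_measure g. h x)
      = (\<integral>\<^sup>+x. ennreal (exp (g (norm x)) * h x) * indicator S x \<partial>lebesgue)"
proof -
  note eq = nn_integral_weighted_measure[OF w h(1)]
  have m: "(\<lambda>x. indicator S x *\<^sub>R h x) \<in> borel_measurable (weighted_measure g)"
    using h(1) by (simp add: weighted_measure_def)
  show i: "set_integrable (weighted_measure g) S h"
    unfolding set_integrable_def
    by (rule integrableI_nonneg[OF m]) (use h(2) eq le in \<open>auto simp: order.strict_trans1\<close>)
  show "ennreal (LINT x:S|weighted_measure g. h x)
      = (\<integral>\<^sup>+x. ennreal (exp (g (norm x)) * h x) * indicator S x \<partial>lebesgue)"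
    unfolding eq[symmetric] set_lebesgue_integral_def using i h(2)
    by (intro nn_integral_eq_integral[symmetric]) (auto simp: set_integrable_def)
  then have "ennreal (LINT x:S|weighted_measure g. h x) \<le> ennreal Z" using le by simp
  then show "(LINT x:S|weighted_measure g. h x) \<le> Z" using le(2) by (subst (asm) ennreal_le_iff) auto
qed

text \<open>The approximating test functions satisfy the inequality, and their gradient energies exceed that of
  \<open>v\<close> by at most the factor \<open>2 powr p\<close> and an error that tends to zero, because the weight is bounded by
  \<open>exp (g R)\<close> on the ball. Fatou's lemma then gives both the integrability and the inequality for \<open>v\<close>;
  the factor \<open>2\<close> in the constant comes from \<open>2 powr p\<close>.\<close>

lemma weighted_gagliardo_nirenberg_W1_0:
  fixes p q n K \<alpha>\<^sub>1 \<alpha>\<^sub>2 R :: real and v :: "'a::euclidean_space \<Rightarrow> real"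
  defines "n \<equiv> real DIM('a)"
  assumes g: "weight_exponent \<alpha>\<^sub>1 \<alpha>\<^sub>2 g" and \<alpha>: "0 < \<alpha>\<^sub>1" "\<alpha>\<^sub>2 \<le> 1" and R: "0 < R"
    and p: "1 < p" "p < n" and q: "p < q" "q < n * p / (n - p)"
    and v: "v \<in> W1_0 p (ball 0 R)"
    and K: "2 * n\<^sup>2 * p / \<alpha>\<^sub>1 \<le> K" "p * (n - 1) / (n - p) \<le> K"
  shows "set_integrable (weighted_measure g) (ball 0 R) (\<lambda>x. \<bar>v x\<bar> powr q)"
    and "(LINT x:ball 0 R|weighted_measure g. \<bar>v x\<bar> powr q) powr (1 / q)
      \<le> 2 * K * (LINT x:ball 0 R|weighted_measure g. norm (weak_grad (ball 0 R) v x) powr p) powr (1 / p)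
          * (g R / R) powr (n * (q - p) / (p * q) - 1)"
proof -
  let ?\<Omega> = "ball 0 R :: 'a set"
  let ?M = "weighted_measure g :: 'a measure"
  define w where "w x = exp (g (norm x))" for x :: 'a
  define W where "W = exp (g R)"
  define h where "h = weak_grad ?\<Omega> v"
  define L where "L = (g R / R) powr (n * (q - p) / (p * q) - 1)"
  have w_cont: "continuous_on UNIV w"
    using weight_exponent_continuous[OF g] by (simp add: w_def[abs_def])
  have w_le: "w x \<le> W" if "x \<in> ?\<Omega>" for x
    using weight_exponent_strict_mono[OF g \<alpha>, of "norm x" R] that by (simp add: w_def W_def)
  have K0: "0 < K"
    using K(1) p \<alpha> by (smt (verit) divide_pos_pos mult_pos_pos zero_less_power)
  have vLp: "v \<in> Lp p ?\<Omega>" and hLp: "h \<in> Lp p ?\<Omega>"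
    using v by (auto simp: W1_0_def W1_def h_def)
  obtain \<phi> where \<phi>: "\<And>k::nat. C1_supported R (\<phi> k)"
    and ae: "AE x in lebesgue. x \<in> ?\<Omega> \<longrightarrow> (\<lambda>k. \<phi> k x) \<longlonglongrightarrow> v x"
    and lim: "(\<lambda>k. LINT x:?\<Omega>|lebesgue. norm (h x - grad (\<phi> k) x) powr p) \<longlonglongrightarrow> 0"
    using W1_0_approximation[OF p(1) v] unfolding h_def by blast
  define e where "e k = (LINT x:?\<Omega>|lebesgue. norm (h x - grad (\<phi> k) x) powr p)" for k
  define B where "B = (LINT x:?\<Omega>|?M. norm (h x) powr p)"
  have e0: "0 \<le> e k" for k
    unfolding e_def set_lebesgue_integral_def by (intro integral_nonneg_AE AE_I2) auto
  have w_meas: "w \<in> borel_measurable lebesgue"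
    using borel_measurable_continuous_onI[OF w_cont] by (auto intro: measurable_completion)
  have ball: "?\<Omega> \<in> sets lebesgue" by (intro sets_completionI_sets) auto

  have h_meas: "(\<lambda>x. indicator ?\<Omega> x *\<^sub>R norm (h x) powr p) \<in> borel_measurable lebesgue"
    and h_int: "set_integrable lebesgue ?\<Omega> (\<lambda>x. norm (h x) powr p)"
    using hLp by (auto simp: Lp_def set_integrable_def dest: borel_measurable_integrable)
  have diff_int: "set_integrable lebesgue ?\<Omega> (\<lambda>x. norm (h x - grad (\<phi> k) x) powr p)" for k
    using p by (intro set_integrable_powr_norm_diff hLp C1_supportedD(2)[OF \<phi>]) auto
  have W_bound: "(\<integral>\<^sup>+x. ennreal (w x * f x) * indicator ?\<Omega> x \<partial>lebesgue) \<le> ennreal (W * (LINT x:?\<Omega>|lebesgue. f x))"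
    if f: "set_integrable lebesgue ?\<Omega> f" "\<And>x. 0 \<le> f x" for f
  proof -
    have "(\<integral>\<^sup>+x. ennreal (w x * f x) * indicator ?\<Omega> x \<partial>lebesgue)
        \<le> (\<integral>\<^sup>+x. ennreal (W * (indicator ?\<Omega> x *\<^sub>R f x)) \<partial>lebesgue)"
      using f(2) w_le by (intro nn_integral_mono) (auto split: split_indicator intro!: ennreal_leI mult_right_mono)
    also have "\<dots> = ennreal (LINT x|lebesgue. W * (indicator ?\<Omega> x *\<^sub>R f x))"
      using f unfolding set_integrable_def by (intro nn_integral_eq_integral) (auto simp: W_def)
    finally show ?thesis by (simp add: set_lebesgue_integral_def)
  qed
  have B_eq: "ennreal B = (\<integral>\<^sup>+x. ennreal (w x * norm (h x) powr p) * indicator ?\<Omega> x \<partial>lebesgue)"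
    and B0: "0 \<le> B"
    unfolding B_def w_def
    subgoal
      by (rule set_integrable_weighted_measure(3)[OF weight_exponent_continuous[OF g] h_meas _
            W_bound[OF h_int, unfolded w_def]])
         (auto simp: W_def set_lebesgue_integral_def intro!: integral_nonneg_AE mult_nonneg_nonneg)
    subgoal
      unfolding set_lebesgue_integral_def by (intro integral_nonneg_AE AE_I2) auto
    done

  define b where "b k = enn2real (grad_energy w p R (\<phi> k))" for k
  have b_le: "b k \<le> 2 powr p * (B + W * e k)" for k
  proof -
    have "grad_energy w p R (\<phi> k)
        = (\<integral>\<^sup>+x. ennreal (w x * norm (grad (\<phi> k) x) powr p) * indicator ?\<Omega> x \<partial>lebesgue)"
      by (simp add: grad_energy_def nn_integral_completion)
    also have "\<dots> \<le> (\<integral>\<^sup>+x. ennreal (2 powr p) * (ennreal (w x * norm (h x) powr p) * indicator ?\<Omega> x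
          + ennreal (w x * norm (h x - grad (\<phi> k) x) powr p) * indicator ?\<Omega> x) \<partial>lebesgue)"
    proof (rule nn_integral_mono)
      fix x
      have "norm (grad (\<phi> k) x) powr p \<le> 2 powr p * (norm (h x) powr p + norm (h x - grad (\<phi> k) x) powr p)"
        using powr_norm_add_le[of p "h x" "grad (\<phi> k) x - h x"] p by (simp add: norm_minus_commute)
      then have "w x * norm (grad (\<phi> k) x) powr p
          \<le> w x * (2 powr p * (norm (h x) powr p + norm (h x - grad (\<phi> k) x) powr p))"
        by (intro mult_left_mono) (auto simp: w_def)
      then have "ennreal (w x * norm (grad (\<phi> k) x) powr p)
          \<le> ennreal (2 powr p * (w x * norm (h x) powr p + w x * norm (h x - grad (\<phi> k) x) powr p))"
        by (intro ennreal_leI) (simp add: algebra_simps)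
      also have "\<dots> = ennreal (2 powr p) * (ennreal (w x * norm (h x) powr p)
          + ennreal (w x * norm (h x - grad (\<phi> k) x) powr p))"
        by (simp add: ennreal_mult' ennreal_plus w_def)
      finally show "ennreal (w x * norm (grad (\<phi> k) x) powr p) * indicator ?\<Omega> x
          \<le> ennreal (2 powr p) * (ennreal (w x * norm (h x) powr p) * indicator ?\<Omega> x
          + ennreal (w x * norm (h x - grad (\<phi> k) x) powr p) * indicator ?\<Omega> x)"
        by (auto split: split_indicator)
    qed
    also have "\<dots> = ennreal (2 powr p) * ((\<integral>\<^sup>+x. ennreal (w x * norm (h x) powr p) * indicator ?\<Omega> x \<partial>lebesgue)
          + (\<integral>\<^sup>+x. ennreal (w x * norm (h x - grad (\<phi> k) x) powr p) * indicator ?\<Omega> x \<partial>lebesgue))"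
    proof -
      have m: "(\<lambda>x. ennreal (w x * f x) * indicator ?\<Omega> x) \<in> borel_measurable lebesgue"
        if "set_integrable lebesgue ?\<Omega> f" for f
      proof -
        have "(\<lambda>x. indicator ?\<Omega> x *\<^sub>R f x) \<in> borel_measurable lebesgue"
          using that by (auto simp: set_integrable_def)
        then have "(\<lambda>x. ennreal (w x * (indicator ?\<Omega> x *\<^sub>R f x))) \<in> borel_measurable lebesgue"
          using w_meas by measurable
        also have "(\<lambda>x. ennreal (w x * (indicator ?\<Omega> x *\<^sub>R f x))) = (\<lambda>x. ennreal (w x * f x) * indicator ?\<Omega> x)"
          by (auto simp: fun_eq_iff split: split_indicator)
        finally show ?thesis .
      qed
      show ?thesis
        using m[OF h_int] m[OF diff_int[of k]] by (simp add: nn_integral_cmult nn_integral_add)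
    qed
    also have "\<dots> \<le> ennreal (2 powr p) * (ennreal B + ennreal (W * e k))"
      unfolding B_eq e_def by (intro mult_left_mono add_left_mono W_bound diff_int) auto
    also have "\<dots> = ennreal (2 powr p * (B + W * e k))"
      using B0 e0[of k] by (simp add: ennreal_mult' ennreal_plus W_def)
    finally have "grad_energy w p R (\<phi> k) \<le> ennreal (2 powr p * (B + W * e k))" .
    then show ?thesis
      using B0 e0[of k] unfolding b_def
      by (intro enn2real_leI) (auto simp: W_def)
  qed

  define Y where "Y = 2 * K * B powr (1 / p) * L"
  have Y0: "0 \<le> Y" using K0 by (simp add: Y_def L_def)
  have energy: "power_energy w q (\<phi> k) \<le> ennreal ((K * (2 powr p * (B + W * e k)) powr (1 / p) * L) powr q)" for k
  proof -
    have "power_energy w q (\<phi> k) \<le> ennreal ((K * b k powr (1 / p) * L) powr q)"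
      using weighted_gagliardo_nirenberg[OF g \<alpha> R p(1) _ q(1) _ \<phi>[of k]] p q K
      by (simp add: n_def b_def L_def w_def[abs_def])
    also have "\<dots> \<le> ennreal ((K * (2 powr p * (B + W * e k)) powr (1 / p) * L) powr q)"
      using b_le[of k] p q K0
      by (intro ennreal_leI powr_mono2 mult_right_mono mult_left_mono) (auto simp: L_def b_def)
    finally show ?thesis .
  qed
  have "(\<lambda>k. (K * (2 powr p * (B + W * e k)) powr (1 / p) * L) powr q)
      \<longlonglongrightarrow> (K * (2 powr p * (B + W * 0)) powr (1 / p) * L) powr q"
    using lim p q B0 e0 K0 unfolding e_def[symmetric]
    by (intro tendsto_powr2 tendsto_intros) (auto simp: L_def W_def)
  also have "K * (2 powr p * (B + W * 0)) powr (1 / p) * L = Y"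
    using p B0 by (simp add: Y_def powr_mult powr_powr)
  finally have lim_Y: "(\<lambda>k. ennreal ((K * (2 powr p * (B + W * e k)) powr (1 / p) * L) powr q)) \<longlonglongrightarrow> ennreal (Y powr q)"
    by (rule tendsto_ennrealI)

  have "(\<integral>\<^sup>+x. ennreal (w x * \<bar>v x\<bar> powr q) * indicator ?\<Omega> x \<partial>lebesgue)
      \<le> (\<integral>\<^sup>+x. liminf (\<lambda>k. ennreal (w x * \<bar>\<phi> k x\<bar> powr q)) \<partial>lebesgue)"
  proof (rule nn_integral_mono_AE, rule AE_mp[OF ae], intro AE_I2 impI)
    fix x assume conv: "x \<in> ?\<Omega> \<longrightarrow> (\<lambda>k. \<phi> k x) \<longlonglongrightarrow> v x"
    show "ennreal (w x * \<bar>v x\<bar> powr q) * indicator ?\<Omega> x \<le> liminf (\<lambda>k. ennreal (w x * \<bar>\<phi> k x\<bar> powr q))"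
    proof (cases "x \<in> ?\<Omega>")
      case True
      then have "(\<lambda>k. w x * \<bar>\<phi> k x\<bar> powr q) \<longlonglongrightarrow> w x * \<bar>v x\<bar> powr q"
        using conv p q by (intro tendsto_mult tendsto_powr2 tendsto_intros) auto
      then have "(\<lambda>k. ennreal (w x * \<bar>\<phi> k x\<bar> powr q)) \<longlonglongrightarrow> ennreal (w x * \<bar>v x\<bar> powr q)"
        by (rule tendsto_ennrealI)
      then show ?thesis using True by (simp add: lim_imp_Liminf)
    qed simp
  qed
  also have "\<dots> \<le> liminf (\<lambda>k. \<integral>\<^sup>+x. ennreal (w x * \<bar>\<phi> k x\<bar> powr q) \<partial>lebesgue)"
  proof (rule nn_integral_liminf)
    fix k
    have "\<phi> k \<in> borel_measurable lebesgue"
      using borel_measurable_continuous_onI[OF C1_supportedD(4)[OF \<phi>[of k]]]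
      by (auto intro: measurable_completion)
    then show "(\<lambda>x. ennreal (w x * \<bar>\<phi> k x\<bar> powr q)) \<in> borel_measurable lebesgue"
      using w_meas by measurable
  qed
  also have "\<dots> \<le> liminf (\<lambda>k. ennreal ((K * (2 powr p * (B + W * e k)) powr (1 / p) * L) powr q))"
    using energy by (intro Liminf_mono always_eventually allI) (simp add: nn_integral_completion power_energy_def)
  also have "\<dots> = ennreal (Y powr q)"
    using lim_Y by (simp add: lim_imp_Liminf)
  finally have main: "(\<integral>\<^sup>+x. ennreal (w x * \<bar>v x\<bar> powr q) * indicator ?\<Omega> x \<partial>lebesgue) \<le> ennreal (Y powr q)" .

  have v_meas: "(\<lambda>x. indicator ?\<Omega> x *\<^sub>R \<bar>v x\<bar> powr q) \<in> borel_measurable lebesgue"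
  proof -
    have "(\<lambda>x. indicator ?\<Omega> x *\<^sub>R v x) \<in> borel_measurable lebesgue"
      using vLp by (auto simp: Lp_def set_borel_measurable_def)
    then have "(\<lambda>x. \<bar>indicator ?\<Omega> x *\<^sub>R v x\<bar> powr q) \<in> borel_measurable lebesgue" by measurable
    also have "(\<lambda>x. \<bar>indicator ?\<Omega> x *\<^sub>R v x\<bar> powr q) = (\<lambda>x. indicator ?\<Omega> x *\<^sub>R \<bar>v x\<bar> powr q)"
      by (auto simp: fun_eq_iff split: split_indicator)
    finally show ?thesis .
  qed
  note final = set_integrable_weighted_measure[OF weight_exponent_continuous[OF g] v_meas _ main[unfolded w_def]]
  show "set_integrable ?M ?\<Omega> (\<lambda>x. \<bar>v x\<bar> powr q)" by (rule final(1)) auto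
  have "(LINT x:?\<Omega>|?M. \<bar>v x\<bar> powr q) \<le> Y powr q" by (rule final(2)) auto
  moreover have "0 \<le> (LINT x:?\<Omega>|?M. \<bar>v x\<bar> powr q)"
    unfolding set_lebesgue_integral_def by (intro integral_nonneg_AE AE_I2) auto
  ultimately have "(LINT x:?\<Omega>|?M. \<bar>v x\<bar> powr q) powr (1 / q) \<le> (Y powr q) powr (1 / q)"
    using p q by (intro powr_mono2) auto
  also have "\<dots> = Y" using Y0 p q by (simp add: powr_powr)
  finally show "(LINT x:?\<Omega>|?M. \<bar>v x\<bar> powr q) powr (1 / q)
      \<le> 2 * K * (LINT x:?\<Omega>|?M. norm (weak_grad ?\<Omega> v x) powr p) powr (1 / p)
          * (g R / R) powr (n * (q - p) / (p * q) - 1)"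
    by (simp add: Y_def B_def L_def h_def)
qed

theorem lemma2p5:
  fixes N p \<alpha>\<^sub>1 \<alpha>\<^sub>2 :: real
  assumes "N = real DIM('a::euclidean_space)"
    and "1 < p" and "p < N"
    and "0 < \<alpha>\<^sub>1" and "\<alpha>\<^sub>1 \<le> \<alpha>\<^sub>2" and "\<alpha>\<^sub>2 < min N (p / (p - 1))"
    and "\<alpha>\<^sub>2 \<le> 1"
    and "(N - p) * \<alpha>\<^sub>1 / (\<alpha>\<^sub>1 + 1) + (p - 1) * (\<alpha>\<^sub>1 - \<alpha>\<^sub>2 / (\<alpha>\<^sub>2 + 1)) \<ge> 0"
  shows "\<exists>C>0. \<forall>g R q a. \<forall>v :: 'a \<Rightarrow> real.
    weight_exponent \<alpha>\<^sub>1 \<alpha>\<^sub>2 g \<and> 0 < R \<and> v \<in> W1_0 p (ball 0 R) \<and>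
    p < q \<and> q < N * p / (N - p) \<and> a = p * q / (q - p) \<longrightarrow>
      set_integrable (weighted_measure g) (ball 0 R) (\<lambda>x. \<bar>v x\<bar> powr q) \<and>
      (LINT x:ball 0 R|weighted_measure g. \<bar>v x\<bar> powr q) powr (1 / q)
        \<le> C * (LINT x:ball 0 R|weighted_measure g.
                  norm (weak_grad (ball 0 R) v x) powr p) powr (1 / p)
            * Lam g R powr (N / a - 1)"
proof -
  define K where "K = max (2 * N\<^sup>2 * p / \<alpha>\<^sub>1) (p * (N - 1) / (N - p))"
  have K: "2 * N\<^sup>2 * p / \<alpha>\<^sub>1 \<le> K" "p * (N - 1) / (N - p) \<le> K" by (auto simp: K_def)
  have "0 < 2 * N\<^sup>2 * p / \<alpha>\<^sub>1" using assms(2-4) by simp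
  then have K0: "0 < K" using K(1) by simp
  show ?thesis
  proof (intro exI[of _ "2 * K"] conjI allI impI; (elim conjE)?)
    fix g R q a and v :: "'a \<Rightarrow> real"
    assume g: "weight_exponent \<alpha>\<^sub>1 \<alpha>\<^sub>2 g" and R: "0 < R" and v: "v \<in> W1_0 p (ball 0 R)"
      and q: "p < q" "q < N * p / (N - p)" and a: "a = p * q / (q - p)"
    note main = weighted_gagliardo_nirenberg_W1_0[OF g assms(4,7) R assms(2) _ q(1) _ v, folded assms(1),
        OF assms(3) q(2) K]
    show "set_integrable (weighted_measure g) (ball 0 R) (\<lambda>x. \<bar>v x\<bar> powr q)" by (rule main(1))
    have Na: "N / a = N * (q - p) / (p * q)" by (simp add: a)
    have exponent: "N / a - 1 \<le> 0"
    proof -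
      have "q * (N - p) < N * p" using q(2) assms(3) by (simp add: pos_less_divide_eq)
      then have "N * (q - p) \<le> 1 * (p * q)" by (simp add: algebra_simps)
      then have "N / a \<le> 1" unfolding Na using q assms(2) by (subst pos_divide_le_eq) auto
      then show ?thesis by simp
    qed
    have "(g R / R) powr (N / a - 1) \<le> Lam g R powr (N / a - 1)"
      using Lam_bounds[OF g assms(4,7) R] by (intro powr_mono2' exponent) auto
    then have "2 * K * (LINT x:ball 0 R|weighted_measure g. norm (weak_grad (ball 0 R) v x) powr p) powr (1 / p)
          * (g R / R) powr (N / a - 1)
        \<le> 2 * K * (LINT x:ball 0 R|weighted_measure g. norm (weak_grad (ball 0 R) v x) powr p) powr (1 / p)
          * Lam g R powr (N / a - 1)"
      using K0 by (intro mult_left_mono) auto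
    then show "(LINT x:ball 0 R|weighted_measure g. \<bar>v x\<bar> powr q) powr (1 / q)
        \<le> 2 * K * (LINT x:ball 0 R|weighted_measure g. norm (weak_grad (ball 0 R) v x) powr p) powr (1 / p)
          * Lam g R powr (N / a - 1)"
      using main(2) unfolding Na by (rule order_trans[rotated])
  qed (use K0 in simp)
qed

end
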